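(* Let $f:\mathbb N\to\mathbb N$ be any function. There exists a finitely generated residually finite group $G$, together with a chain $G>M_1>M_2>\cdots$ of normal subgroups of finite index in $G$ such that $\bigcap_i M_i=\{1\}$ and \[ T_1(M_i)>f([G:M_i])\quad\text{for all } i\in\mathbb N, \] where $T_1(M_i)$ is the order of the torsion subgroup of $H_1(M_i,\mathbb Z)$. In fact, for every $f$, such a $G$ can be found which is a solvable group of derived length $3$; and, for every $f$, such a $G$ can also be found which has an abelian normal subgroup with quotient isomorphic to Grigorchuk's $2$-group of subexponential growth.
   Context: Grigorchuk's $2$-group is the first Grigorchuk group, the finitely generated infinite residually finite $2$-group of intermediate growth acting on the rooted binary tree. *)

theory Defs
  imports "HOL-Algebra.Algebra"
begin

definition finitely_generated :: "('a, 'b) monoid_scheme \<Rightarrow> bool" where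
  "finitely_generated G \<longleftrightarrow> (\<exists>S. finite S \<and> S \<subseteq> carrier G \<and> generate G S = carrier G)"

definition finite_index :: "('a, 'b) monoid_scheme \<Rightarrow> 'a set \<Rightarrow> bool" where
  "finite_index G H \<longleftrightarrow> finite (rcosets\<^bsub>G\<^esub> H)"

definition subgroup_index :: "('a, 'b) monoid_scheme \<Rightarrow> 'a set \<Rightarrow> nat" where
  "subgroup_index G H = card (rcosets\<^bsub>G\<^esub> H)"

definition residually_finite :: "('a, 'b) monoid_scheme \<Rightarrow> bool" where
  "residually_finite G \<longleftrightarrow>
     (\<forall>g \<in> carrier G - {\<one>\<^bsub>G\<^esub>}. \<exists>N. N \<lhd> G \<and> finite_index G N \<and> g \<notin> N)"

text \<open>The value is the derived length only if \<open>G\<close> is solvable; otherwise the \<open>LEAST\<close> is arbitrary.\<close>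

definition derived_length :: "('a, 'b) monoid_scheme \<Rightarrow> nat" where
  "derived_length G = (LEAST n. (derived G ^^ n) (carrier G) = {\<one>\<^bsub>G\<^esub>})"


subsection \<open>Integral group homology\<close>

text \<open>
  The homology of \<open>G\<close> with coefficients in the trivial module of the integers is computed by the
  inhomogeneous bar complex: the chains of degree \<open>n\<close> are the free abelian group on the \<open>n\<close>-tuples
  \<open>[g\<^sub>1|...|g\<^sub>n]\<close>, here lists of length \<open>n\<close>, and the boundary of \<open>[g\<^sub>1|...|g\<^sub>n]\<close> is
  \<open>[g\<^sub>2|...|g\<^sub>n] + \<Sum>\<^sub>k (-1)^k [g\<^sub>1|...|g\<^sub>k g\<^sub>k\<^sub>+\<^sub>1|...|g\<^sub>n] + (-1)^n [g\<^sub>1|...|g\<^sub>n\<^sub>-\<^sub>1]\<close>,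
  where \<open>k\<close> ranges over \<open>1, ..., n - 1\<close>.
\<close>

definition bar_chains :: "('a, 'b) monoid_scheme \<Rightarrow> nat \<Rightarrow> ('a list \<Rightarrow>\<^sub>0 int) monoid" where
  "bar_chains G n = free_Abelian_group {gs. length gs = n \<and> set gs \<subseteq> carrier G}"

definition bar_face :: "('a, 'b) monoid_scheme \<Rightarrow> nat \<Rightarrow> 'a list \<Rightarrow> 'a list" where
  "bar_face G k gs =
     (if k = 0 then tl gs
      else if k = length gs then butlast gs
      else take (k - 1) gs @ (gs ! (k - 1) \<otimes>\<^bsub>G\<^esub> gs ! k) # drop (k + 1) gs)"

definition bar_boundary ::
    "('a, 'b) monoid_scheme \<Rightarrow> nat \<Rightarrow> ('a list \<Rightarrow>\<^sub>0 int) \<Rightarrow> ('a list \<Rightarrow>\<^sub>0 int)" where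
  "bar_boundary G n c =
     (if n = 0 then 0
      else frag_extend (\<lambda>gs. \<Sum>k\<le>n. frag_cmul ((-1) ^ k) (frag_of (bar_face G k gs))) c)"

definition group_homology ::
    "nat \<Rightarrow> ('a, 'b) monoid_scheme \<Rightarrow> ('a list \<Rightarrow>\<^sub>0 int) set monoid" where
  "group_homology n G =
     (bar_chains G n)
       \<lparr>carrier := kernel (bar_chains G n) (bar_chains G (n - 1)) (bar_boundary G n)\<rparr>
     Mod (bar_boundary G (Suc n) ` carrier (bar_chains G (Suc n)))"

lemma bar_boundary_1: "bar_boundary G 1 (frag_of [g]) = 0"
  by (simp add: bar_boundary_def bar_face_def)

lemma bar_boundary_2:
  "bar_boundary G 2 (frag_of [g, h]) = frag_of [h] - frag_of [g \<otimes>\<^bsub>G\<^esub> h] + frag_of [g]"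
  by (simp add: bar_boundary_def bar_face_def numeral_2_eq_2)

definition torsion_subgroup :: "('a, 'b) monoid_scheme \<Rightarrow> 'a set" where
  "torsion_subgroup A = {x \<in> carrier A. \<exists>n::nat. n > 0 \<and> x [^]\<^bsub>A\<^esub> n = \<one>\<^bsub>A\<^esub>}"

text \<open>
  The value is \<open>0\<close> if the torsion subgroup is infinite, so that a strict lower bound on it
  includes the finiteness of the torsion subgroup.
\<close>

definition T1 :: "('a, 'b) monoid_scheme \<Rightarrow> nat" where
  "T1 G = card (torsion_subgroup (group_homology 1 G))"


subsection \<open>Grigorchuk's 2-group\<close>

text \<open>
  The vertices of the rooted binary tree are the finite words over \<open>{0, 1}\<close>, with \<open>0\<close> encoded as
  \<open>False\<close> and \<open>1\<close> as \<open>True\<close>. In wreath recursion, \<open>a\<close> exchanges the two subtrees at the root and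
  \<open>b = (a, c)\<close>, \<open>c = (a, d)\<close>, \<open>d = (1, b)\<close>.
\<close>

fun grig_a :: "bool list \<Rightarrow> bool list" where
  "grig_a [] = []"
| "grig_a (x # w) = (\<not> x) # w"

fun grig_b :: "bool list \<Rightarrow> bool list"
  and grig_c :: "bool list \<Rightarrow> bool list"
  and grig_d :: "bool list \<Rightarrow> bool list" where
  "grig_b [] = []"
| "grig_b (False # w) = False # grig_a w"
| "grig_b (True # w) = True # grig_c w"
| "grig_c [] = []"
| "grig_c (False # w) = False # grig_a w"
| "grig_c (True # w) = True # grig_d w"
| "grig_d [] = []"
| "grig_d (False # w) = False # w"
| "grig_d (True # w) = True # grig_b w"

definition grigorchuk_group :: "(bool list \<Rightarrow> bool list) monoid" where
  "grigorchuk_group = subgroup_generated (BijGroup UNIV) {grig_a, grig_b, grig_c, grig_d}"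

text \<open>
  \<open>subgroup_generated\<close> drops generators outside the carrier of the ambient group; none is dropped.
\<close>

lemma grig_a_involution: "grig_a (grig_a w) = w"
  by (cases w) auto

lemma grig_bcd_involution:
  "grig_b (grig_b w) = w" "grig_c (grig_c w) = w" "grig_d (grig_d w) = w"
  by (induction w rule: grig_b_grig_c_grig_d.induct) (auto simp: grig_a_involution)

lemma grig_generators_in_carrier:
  "{grig_a, grig_b, grig_c, grig_d} \<subseteq> carrier (BijGroup UNIV)"
  by (simp add: BijGroup_def Bij_def involuntory_imp_bij grig_a_involution grig_bcd_involution)


subsection \<open>Chains with large torsion in homology\<close>

text \<open>The set \<open>M i\<close> is the \<open>(i + 1)\<close>-st term of the chain; all inclusions are proper.
  Finitely generated groups are countable, so up to isomorphism each of them has a set of natural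
  numbers as its carrier, and existence can be stated for \<open>nat monoid\<close>.\<close>

definition torsion_growth_chain ::
    "(nat \<Rightarrow> nat) \<Rightarrow> ('a, 'b) monoid_scheme \<Rightarrow> (nat \<Rightarrow> 'a set) \<Rightarrow> bool" where
  "torsion_growth_chain f G M \<longleftrightarrow>
     M 0 \<subset> carrier G \<and>
     (\<forall>i. M (Suc i) \<subset> M i) \<and>
     (\<forall>i. M i \<lhd> G \<and> finite_index G (M i)) \<and>
     (\<Inter>i. M i) = {\<one>\<^bsub>G\<^esub>} \<and>
     (\<forall>i. T1 (G\<lparr>carrier := M i\<rparr>) > f (subgroup_index G (M i)))"

end

theory Submission
  imports Defs
begin

text \<open>
  Let \<open>\<Gamma>\<close> be finitely generated with a descending chain of normal subgroups \<open>N i\<close> of finite index and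
  trivial intersection, and let \<open>U i \<supseteq> N i\<close> be subgroups with elements \<open>g i\<close> that lie in \<open>U k\<close> for
  all \<open>k > i\<close>, but not in \<open>U i\<close>. Let \<open>G\<close> be generated by \<open>\<Gamma>\<close> and one element \<open>t\<close> of the product of the
  permutation modules of functions from \<open>\<Gamma> / U i\<close> to the integers modulo \<open>q i\<close>, namely the sequence
  of the delta functions at the trivial cosets. The commutator of \<open>g i\<close> and \<open>t\<close>
  vanishes in the components beyond \<open>i\<close>. If \<open>q j\<close> divides \<open>q (i - 1)\<close> for all \<open>j < i\<close>, then its \<open>q (i - 1)\<close>-th
  power lives in component \<open>i\<close> only. This is a torsion element of the normal subgroup \<open>M i\<close> of those
  elements that lie over \<open>N i\<close> and vanish in the components before \<open>i\<close>, and it survives in the homology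
  of \<open>M i\<close>, because \<open>N i\<close> acts trivially on component \<open>i\<close>. As the index of \<open>M i\<close> depends only on \<open>q j\<close> for \<open>j < i\<close>,
  its order can be made as large as desired by the choice of \<open>q i\<close>.

  For derived length 3, \<open>\<Gamma>\<close> is the lamplighter group, itself such a group over the integers with all
  moduli equal to 2, and \<open>g i\<close> is the lamp at \<open>i\<close>. For Grigorchuk's group, \<open>U i\<close> is the stabilizer of a vertex
  below \<open>1\<^sup>i 0\<close> and \<open>g i\<close> is an element acting only below \<open>1\<^sup>i 0\<close>.
\<close>

section \<open>Finiteness of torsion\<close>

text \<open>Schreier's lemma: with \<open>\<rho>\<close> choosing representatives of right cosets,
  the finitely many Schreier elements \<open>w t s\<close> generate \<open>M\<close>, because they
  telescope along a word.\<close>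

lemma (in group) subgroup_finitely_generated:
  assumes S: "finite S" "S \<subseteq> carrier G" "generate G S = carrier G"
    and M: "subgroup M G" and fin: "finite (rcosets M)"
  shows "\<exists>T. finite T \<and> T \<subseteq> M \<and> generate G T = M"
proof -
  interpret M: subgroup M G by fact
  \<comment> \<open>Choosing \<open>\<one>\<close> for the coset \<open>M\<close> gives
    \<open>w \<one> m = m\<close> for \<open>m \<in> M\<close> at the end.\<close>
  define r where "r C = (if C = M then \<one> else SOME x. x \<in> C)" for C
  define \<rho> where "\<rho> g = r (M #> g)" for g
  have \<rho>_in: "\<rho> g \<in> M #> g" if "g \<in> carrier G" for g
    using rcos_self[OF that M] by (auto simp: \<rho>_def r_def intro: someI)
  have \<rho>_carrier: "\<rho> g \<in> carrier G" if "g \<in> carrier G" for g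
    using \<rho>_in[OF that] r_coset_subset_G[OF M.subset that] by blast
  have coset_\<rho>: "M #> \<rho> g = M #> g" if "g \<in> carrier G" for g
    using repr_independence[OF \<rho>_in[OF that] that M] by simp
  have \<rho>_\<rho>: "\<rho> (\<rho> g \<otimes> h) = \<rho> (g \<otimes> h)" if "g \<in> carrier G" "h \<in> carrier G" for g h
  proof -
    have "M #> (\<rho> g \<otimes> h) = M #> (g \<otimes> h)"
      using that coset_\<rho> \<rho>_carrier by (metis M.subset coset_mult_assoc)
    then show ?thesis by (simp add: \<rho>_def)
  qed
  have diff: "x \<otimes> inv (\<rho> x) \<in> M" if x: "x \<in> carrier G" for x
  proof -
    obtain m where m: "m \<in> M" "\<rho> x = m \<otimes> x" using \<rho>_in[OF x] by (auto simp: r_coset_def)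
    then have "x \<otimes> inv (\<rho> x) = inv m" using x M.subset by (auto simp: inv_mult_group m_assoc[symmetric])
    then show ?thesis using m by simp
  qed
  have \<rho>_M: "\<rho> m = \<one>" if "m \<in> M" for m
    using that by (simp add: \<rho>_def r_def M.rcos_const)
  define R where "R = \<rho> ` carrier G"
  have "R = r ` (rcosets M)"
    by (auto simp: R_def \<rho>_def RCOSETS_def image_iff)
  then have "finite R" using fin by simp
  have R: "R \<subseteq> carrier G" using \<rho>_carrier by (auto simp: R_def)
  have \<rho>_R: "\<rho> t = t" if t: "t \<in> R" for t
  proof -
    obtain g where g: "g \<in> carrier G" "t = \<rho> g" using t by (auto simp: R_def)
    show ?thesis using \<rho>_\<rho>[OF g(1) one_closed] g \<rho>_carrier by simp
  qed
  define S' where "S' = S \<union> m_inv G ` S"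
  have S': "S' \<subseteq> carrier G" "finite S'" using S by (auto simp: S'_def)
  define w where "w t s = t \<otimes> s \<otimes> inv (\<rho> (t \<otimes> s))" for t s
  define T where "T = (\<lambda>(t, s). w t s) ` (R \<times> S')"
  have T: "finite T" "T \<subseteq> M"
    using \<open>finite R\<close> S' R by (auto simp: T_def w_def intro!: diff)
  \<comment> \<open>All representatives \<open>t\<close> are treated at once, because the cocycle
    rule \<open>w t (g \<otimes> h) = w t g \<otimes> w (\<rho> (t \<otimes> g)) h\<close> changes
    \<open>t\<close>.\<close>
  have key: "\<forall>t\<in>R. w t g \<in> generate G T" if "g \<in> generate G S" for g
    using that
  proof (induction rule: generate.induct)
    case one
    show ?case
    proof
      fix t assume t: "t \<in> R"
      then have "w t \<one> = \<one>" using \<rho>_R R by (auto simp: w_def)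
      then show "w t \<one> \<in> generate G T" by (simp add: generate.one)
    qed
  next
    case (incl s) then show ?case by (auto simp: T_def S'_def intro!: generate.incl)
  next
    case (inv s) then show ?case by (auto simp: T_def S'_def intro!: generate.incl)
  next
    case (eng g h)
    have gh: "g \<in> carrier G" "h \<in> carrier G"
      using eng generate_in_carrier S by auto
    show ?case
    proof
      fix t assume t: "t \<in> R"
      then have tc: "t \<in> carrier G" using R by auto
      have 1: "\<rho> (t \<otimes> g) \<in> R" using tc gh by (auto simp: R_def)
      have "w t (g \<otimes> h) = w t g \<otimes> w (\<rho> (t \<otimes> g)) h"
        using tc gh \<rho>_carrier \<rho>_\<rho> by (simp add: w_def m_assoc inv_solve_left)
      then show "w t (g \<otimes> h) \<in> generate G T"
        using eng t 1 by (simp add: generate.eng)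
    qed
  qed
  have "M \<subseteq> generate G T"
  proof
    fix m assume m: "m \<in> M"
    have "\<one> \<in> R" using \<rho>_M[OF M.one_closed] by (force simp: R_def)
    then have "w \<one> m \<in> generate G T" using key S m M.subset by auto
    then show "m \<in> generate G T" using m \<rho>_M M.subset by (auto simp: w_def)
  qed
  then show ?thesis
    using T generate_subgroup_incl[OF T(2) M] by blast
qed

text \<open>Elements of the larger group have the form \<open>k \<otimes> s [^] m\<close>. If a
  positive power of \<open>s\<close> lies in \<open>K\<close>, finitely many exponents suffice
  modulo \<open>K\<close>; otherwise only \<open>m = 0\<close> gives torsion modulo
  \<open>K\<close>.\<close>

lemma (in comm_group) cyclic_extension_torsion:
  assumes K: "subgroup K G" and s: "s \<in> carrier G"
  shows "\<exists>F. finite F \<and> F \<subseteq> carrier G \<and>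
    {x \<in> generate G (insert s K). \<exists>n::nat. n > 0 \<and> x [^] n \<in> K} \<subseteq> K <#> F"
proof -
  interpret K: subgroup K G by fact
  have form: "\<exists>k\<in>K. \<exists>m::int. x = k \<otimes> s [^] m" if "x \<in> generate G (insert s K)" for x
    using that
  proof (induction rule: generate.induct)
    case one
    show ?case by (rule bexI[of _ \<one>], rule exI[of _ 0]) auto
  next
    case (incl h)
    show ?case
    proof (cases "h = s")
      case True
      then show ?thesis using s by (intro bexI[of _ \<one>] exI[of _ 1]) (auto simp: int_pow_1)
    next
      case False
      then show ?thesis using incl by (intro bexI[of _ h] exI[of _ 0]) auto
    qed
  next
    case (inv h)
    show ?case
    proof (cases "h = s")
      case True
      then show ?thesis using s
        by (intro bexI[of _ \<one>] exI[of _ "-1"]) (auto simp: int_pow_neg int_pow_1)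
    next
      case False
      then show ?thesis using inv by (intro bexI[of _ "inv h"] exI[of _ 0]) auto
    qed
  next
    case (eng g h)
    then obtain k1 k2 m1 m2 where km: "k1 \<in> K" "k2 \<in> K" "g = k1 \<otimes> s [^] (m1::int)" "h = k2 \<otimes> s [^] (m2::int)"
      by auto
    have "g \<otimes> h = (k1 \<otimes> k2) \<otimes> s [^] (m1 + m2)"
      using km s by (simp add: int_pow_mult m_ac)
    then show ?case using km by blast
  qed
  show ?thesis
  proof (cases "\<exists>r::nat. r > 0 \<and> s [^] r \<in> K")
    case True
    then obtain r :: nat where r: "r > 0" "s [^] r \<in> K" by blast
    have "x \<in> K <#> (\<lambda>b. s [^] (b::nat)) ` {..<r}" if "x \<in> generate G (insert s K)" for x
    proof -
      obtain k m where km: "k \<in> K" "x = k \<otimes> s [^] (m::int)" using form \<open>x \<in> _\<close> by blast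
      have "s [^] m = s [^] (int r * (m div int r) + m mod int r)" by simp
      also have "\<dots> = (s [^] int r) [^] (m div int r) \<otimes> s [^] (m mod int r)"
        using s by (simp only: int_pow_mult int_pow_pow)
      also have "s [^] (m mod int r) = s [^] nat (m mod int r)"
        using r s by (metis int_pow_int nat_0_le of_nat_0_less_iff pos_mod_sign)
      finally have "x = (k \<otimes> (s [^] int r) [^] (m div int r)) \<otimes> s [^] nat (m mod int r)"
        using km s by (simp add: m_assoc)
      moreover have "(s [^] int r) [^] (m div int r) \<in> K"
        using r subgroup_int_pow_closed[OF K] by (simp add: int_pow_int)
      moreover have "nat (m mod int r) < r" using r by (simp add: nat_less_iff)
      ultimately show ?thesis unfolding set_mult_def using km(1)
        by (blast intro: K.m_closed)
    qed
    then show ?thesis using s by (intro exI[of _ "(\<lambda>b. s [^] (b::nat)) ` {..<r}"]) auto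
  next
    case False
    have "x \<in> K" if x: "x \<in> generate G (insert s K)" "n > 0" "x [^] (n::nat) \<in> K" for x n
    proof -
      obtain k m where km: "k \<in> K" "x = k \<otimes> s [^] (m::int)" using form x by blast
      have "x [^] n = k [^] n \<otimes> s [^] (m * int n)"
        using km(1) s by (simp add: km(2) nat_pow_distrib int_pow_pow flip: int_pow_int[of G "s [^] m"])
      moreover have "k [^] n \<in> K" using km subgroup_int_pow_closed[OF K, of k "int n"] by (simp add: int_pow_int)
      ultimately have *: "s [^] (m * int n) \<in> K"
        using x(3) km s by (metis K.mem_carrier K.m_inv_closed K.m_closed inv_solve_left int_pow_closed m_closed)
      have "m = 0"
      proof (rule ccontr)
        assume "m \<noteq> 0"
        have "s [^] (\<bar>m\<bar> * int n) \<in> K"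
          using * K.m_inv_closed[OF *] s by (auto simp: abs_if int_pow_neg)
        then have "s [^] (nat \<bar>m\<bar> * n) \<in> K"
          by (simp flip: int_pow_int)
        moreover have "nat \<bar>m\<bar> * n > 0" using \<open>m \<noteq> 0\<close> x by simp
        ultimately show False using False by blast
      qed
      then show ?thesis using km by auto
    qed
    then show ?thesis by (intro exI[of _ "{\<one>}"]) (force simp: set_mult_def)
  qed
qed

text \<open>In terms of quotients, the torsion of a finitely generated extension modulo
  \<open>K\<close> is finite. Adding one generator \<open>s\<close> and varying \<open>K\<close>
  separates the torsion modulo the enlarged subgroup \<open>K'\<close> from the cyclic extension of
  \<open>K\<close> to \<open>K'\<close>.\<close>

lemma (in comm_group) torsion_finite_modulo_subgroup:
  assumes "finite S" "S \<subseteq> carrier G" "subgroup K G"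
  shows "\<exists>F. finite F \<and> F \<subseteq> carrier G \<and>
    {x \<in> generate G (K \<union> S). \<exists>n::nat. n > 0 \<and> x [^] n \<in> K} \<subseteq> K <#> F"
  using assms
proof (induction S arbitrary: K rule: finite_induct)
  case empty
  then have "generate G K \<subseteq> K" by (simp add: generate_subgroup_incl)
  then show ?case
    using subgroup.subset[OF empty(2)] by (intro exI[of _ "{\<one>}"]) (force simp: set_mult_def)
next
  case (insert s S)
  interpret K: subgroup K G by fact
  have s: "s \<in> carrier G" using insert by auto
  define K' where "K' = generate G (insert s K)"
  have K': "subgroup K' G" unfolding K'_def using s K.subset by (intro generate_is_subgroup) auto
  interpret K': subgroup K' G by fact
  define tors where "tors = {x \<in> carrier G. \<exists>n::nat. n > 0 \<and> x [^] n \<in> K}"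
  have KK': "insert s K \<subseteq> K'" by (auto simp: K'_def intro: generate.incl)
  obtain F' where F': "finite F'" "F' \<subseteq> carrier G"
    "{x \<in> generate G (K' \<union> S). \<exists>n::nat. n > 0 \<and> x [^] n \<in> K'} \<subseteq> K' <#> F'"
    using insert.IH[OF _ K'] insert.prems by auto
  obtain F'' where F'': "finite F''" "F'' \<subseteq> carrier G"
    "{x \<in> K'. \<exists>n::nat. n > 0 \<and> x [^] n \<in> K} \<subseteq> K <#> F''"
    using cyclic_extension_torsion[OF insert.prems(2) s] by (auto simp: K'_def)
  \<comment> \<open>A coset of \<open>K'\<close> that meets the torsion modulo \<open>K\<close> gets
    a representative that is itself torsion modulo \<open>K\<close>, so that
    \<open>x \<otimes> inv (p f)\<close> remains torsion modulo \<open>K\<close>.\<close>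
  define p where "p f = (SOME x. x \<in> tors \<inter> (K' #> f))" for f
  define F where "F = (\<lambda>(a, f). a \<otimes> p f) ` (F'' \<times> {f \<in> F'. tors \<inter> (K' #> f) \<noteq> {}})"
  have p: "p f \<in> tors \<inter> (K' #> f)" if "tors \<inter> (K' #> f) \<noteq> {}" for f
    unfolding p_def using that by (intro someI_ex[of "\<lambda>x. x \<in> tors \<inter> (K' #> f)"]) auto
  have "finite F" using F' F'' by (auto simp: F_def)
  moreover have "F \<subseteq> carrier G" using p F'' by (fastforce simp: F_def tors_def)
  moreover have "x \<in> K <#> F" if x: "x \<in> generate G (K \<union> insert s S)" "n > 0" "x [^] (n::nat) \<in> K" for x n
  proof -
    have xc: "x \<in> carrier G" using x(1) insert.prems(1) K.subset
      by (intro generate_in_carrier[of "K \<union> insert s S"]) auto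
    have "generate G (K \<union> insert s S) \<subseteq> generate G (K' \<union> S)"
      using KK' by (intro mono_generate) auto
    then have "x \<in> K' <#> F'" using F'(3) x KK' by blast
    then obtain f where f: "f \<in> F'" "x \<in> K' #> f" by (auto simp: set_mult_def r_coset_def)
    have fc: "f \<in> carrier G" using f F' by auto
    have xt: "x \<in> tors" using x xc by (auto simp: tors_def)
    then have ne: "tors \<inter> (K' #> f) \<noteq> {}" using f by auto
    have pf: "p f \<in> tors" "p f \<in> K' #> f" using p[OF ne] by auto
    have pc: "p f \<in> carrier G" using pf by (auto simp: tors_def)
    define y where "y = x \<otimes> inv (p f)"
    have yc: "y \<in> carrier G" using xc pc by (simp add: y_def)
    have "y \<in> K'"
    proof -
      obtain k1 k2 where k: "k1 \<in> K'" "k2 \<in> K'" "x = k1 \<otimes> f" "p f = k2 \<otimes> f"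
        using f(2) pf(2) by (auto simp: r_coset_def)
      have kc: "k1 \<in> carrier G" "k2 \<in> carrier G" using k K'.subset by auto
      have "y = k1 \<otimes> (f \<otimes> (inv f \<otimes> inv k2))"
        using kc fc k by (simp add: y_def inv_mult_group m_assoc)
      also have "\<dots> = k1 \<otimes> inv k2" using kc fc by (simp add: m_assoc[symmetric])
      finally show ?thesis using k by simp
    qed
    moreover obtain m where m: "m > 0" "p f [^] (m::nat) \<in> K" using pf by (auto simp: tors_def)
    have "y [^] (n * m) \<in> K"
    proof -
      have "y [^] (n * m) = (x [^] n) [^] m \<otimes> inv ((p f [^] m) [^] n)"
        using xc pc by (simp add: y_def nat_pow_distrib nat_pow_pow mult.commute nat_pow_inv)
      moreover have "(x [^] n) [^] m \<in> K" "(p f [^] m) [^] n \<in> K"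
        using x m subgroup_int_pow_closed[OF insert.prems(2), of _ "int _"] by (simp_all add: int_pow_int)
      ultimately show ?thesis by simp
    qed
    moreover have "n * m > 0" using x m by simp
    ultimately have "y \<in> {x \<in> K'. \<exists>n::nat. n > 0 \<and> x [^] n \<in> K}" by blast
    then have "y \<in> K <#> F''" using F''(3) by blast
    then obtain k a where ka: "k \<in> K" "a \<in> F''" "y = k \<otimes> a" by (auto simp: set_mult_def)
    have "x = k \<otimes> (a \<otimes> p f)"
    proof -
      have "x = y \<otimes> p f" using xc pc by (simp add: y_def m_assoc)
      then show ?thesis using ka F'' pc by (auto simp: m_assoc)
    qed
    moreover have "a \<otimes> p f \<in> F" using ka f ne by (auto simp: F_def)
    ultimately show ?thesis using ka by (auto simp: set_mult_def)
  qed
  ultimately show ?case by blast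
qed

text \<open>Lower bounds on \<open>T1\<close> rest on this finiteness: as a cardinality,
  \<open>T1\<close> would be 0 for an infinite torsion subgroup.\<close>

lemma (in comm_group) finite_torsion_subgroup:
  assumes "finitely_generated G"
  shows "finite (torsion_subgroup G)"
proof -
  obtain S where S: "finite S" "S \<subseteq> carrier G" "generate G S = carrier G"
    using assms by (auto simp: finitely_generated_def)
  obtain F where F: "finite F" "F \<subseteq> carrier G"
    "{x \<in> generate G ({\<one>} \<union> S). \<exists>n::nat. n > 0 \<and> x [^] n \<in> {\<one>}} \<subseteq> {\<one>} <#> F"
    using torsion_finite_modulo_subgroup[OF S(1,2) triv_subgroup] by blast
  have "carrier G \<subseteq> generate G ({\<one>} \<union> S)"
    unfolding S(3)[symmetric] by (intro mono_generate) auto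
  then have "torsion_subgroup G \<subseteq> F"
    using F(2,3) by (auto simp: torsion_subgroup_def set_mult_def subset_iff)
  then show ?thesis using F(1) finite_subset by blast
qed

section \<open>The first homology group\<close>

abbreviation bar_boundaries :: "('a, 'b) monoid_scheme \<Rightarrow> ('a list \<Rightarrow>\<^sub>0 int) set" where
  "bar_boundaries G \<equiv> bar_boundary G 2 ` carrier (bar_chains G 2)"

lemma carrier_bar_chains: "c \<in> carrier (bar_chains G n) \<longleftrightarrow>
    Poly_Mapping.keys c \<subseteq> {gs. length gs = n \<and> set gs \<subseteq> carrier G}"
  by (simp add: bar_chains_def)

lemma one_bar_chains: "\<one>\<^bsub>bar_chains G n\<^esub> = 0"
  by (simp add: bar_chains_def)

lemma bar_boundary_diff: "bar_boundary G n (x - y) = bar_boundary G n x - bar_boundary G n y"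
  by (simp add: bar_boundary_def frag_extend_diff)

lemma bar_boundary_add: "bar_boundary G n (x + y) = bar_boundary G n x + bar_boundary G n y"
  by (simp add: bar_boundary_def frag_extend_add)

text \<open>Both faces of \<open>[g]\<close> are the empty list and enter with opposite signs. Hence
  every chain of degree 1 is a cycle.\<close>

lemma bar_boundary_1_eq_0:
  assumes "c \<in> carrier (bar_chains G 1)" shows "bar_boundary G 1 c = 0"
proof -
  have "Poly_Mapping.keys c \<subseteq> {gs. length gs = 1 \<and> set gs \<subseteq> carrier G}"
    using assms by (simp add: carrier_bar_chains)
  then show ?thesis
  proof (induction rule: free_Abelian_group_induct[consumes 1, case_names zero diff of])
    case zero then show ?case by (simp add: bar_boundary_def)
  next
    case (diff x y) then show ?case by (simp add: bar_boundary_diff)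
  next
    case (of gs)
    then obtain g where "gs = [g]" by (auto simp: length_Suc_conv)
    then show ?case using bar_boundary_1 by simp
  qed
qed

lemma group_homology_1:
  "group_homology 1 G = bar_chains G 1 Mod bar_boundaries G"
proof -
  have "kernel (bar_chains G 1) (bar_chains G 0) (bar_boundary G 1) = carrier (bar_chains G 1)"
    using bar_boundary_1_eq_0[of _ G] by (auto simp: kernel_def one_bar_chains simp del: One_nat_def)
  then show ?thesis by (simp add: group_homology_def numeral_2_eq_2)
qed

lemma bar_2_cases:
  assumes "length gs = 2" "set gs \<subseteq> carrier G"
  obtains g h where "gs = [g, h]" "g \<in> carrier G" "h \<in> carrier G"
  using assms by (auto simp: length_Suc_conv numeral_2_eq_2)

context group begin

lemma bar_boundary_2_closed:
  assumes "c \<in> carrier (bar_chains G 2)" shows "bar_boundary G 2 c \<in> carrier (bar_chains G 1)"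
proof -
  have "Poly_Mapping.keys c \<subseteq> {gs. length gs = 2 \<and> set gs \<subseteq> carrier G}"
    using assms by (simp add: carrier_bar_chains)
  then show ?thesis
  proof (induction rule: free_Abelian_group_induct[consumes 1, case_names zero diff of])
    case zero then show ?case by (simp add: bar_boundary_def carrier_bar_chains)
  next
    case (diff x y)
    then show ?case using keys_diff[of "bar_boundary G 2 x" "bar_boundary G 2 y"]
      by (simp add: bar_boundary_diff carrier_bar_chains) blast
  next
    case (of gs)
    then obtain g h where gs: "gs = [g, h]" "g \<in> carrier G" "h \<in> carrier G"
      using bar_2_cases by blast
    have "Poly_Mapping.keys (frag_of [h] - frag_of [g \<otimes> h] + frag_of [g]) \<subseteq> {[h], [g \<otimes> h], [g]}"
      by (rule order_trans[OF keys_add]) (use keys_diff[of "frag_of [h]" "frag_of [g \<otimes> h]"] in auto)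
    then show ?case using gs by (auto simp: carrier_bar_chains bar_boundary_2)
  qed
qed

lemma bar_boundaries_subgroup: "subgroup (bar_boundaries G) (bar_chains G 1)"
proof -
  have "bar_boundary G 2 \<in> hom (bar_chains G 2) (bar_chains G 1)"
    using bar_boundary_2_closed by (auto simp: hom_def bar_boundary_add bar_chains_def)
  then show ?thesis
    using group_hom.img_is_subgroup[of "bar_chains G 2" "bar_chains G 1"]
    by (simp add: group_hom_def group_hom_axioms_def bar_chains_def)
qed

lemma bar_boundaries_normal: "bar_boundaries G \<lhd> bar_chains G 1"
  using comm_group.subgroup_imp_normal[OF _ bar_boundaries_subgroup]
  by (simp add: bar_chains_def abelian_free_Abelian_group)

lemma comm_group_homology_1: "comm_group (group_homology 1 G)"
  unfolding group_homology_1
  by (rule comm_group.abelian_FactGroup[OF _ bar_boundaries_subgroup])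
    (simp add: bar_chains_def abelian_free_Abelian_group)

text \<open>The canonical map from \<open>G\<close> to its first homology, that is, to its
  abelianization.\<close>

definition bar_class :: "'a \<Rightarrow> ('a list \<Rightarrow>\<^sub>0 int) set" where
  "bar_class g = bar_boundaries G #>\<^bsub>bar_chains G 1\<^esub> frag_of [g]"

lemma frag_of_in_bar_chains_1: "g \<in> carrier G \<Longrightarrow> frag_of [g] \<in> carrier (bar_chains G 1)"
  by (simp add: carrier_bar_chains)

lemma bar_coset_eq_iff:
  assumes "x \<in> carrier (bar_chains G 1)" "y \<in> carrier (bar_chains G 1)"
  shows "bar_boundaries G #>\<^bsub>bar_chains G 1\<^esub> x = bar_boundaries G #>\<^bsub>bar_chains G 1\<^esub> y
    \<longleftrightarrow> x - y \<in> bar_boundaries G"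
proof -
  interpret C: group "bar_chains G 1" by (simp add: bar_chains_def)
  interpret B: subgroup "bar_boundaries G" "bar_chains G 1" by (rule bar_boundaries_subgroup)
  have *: "(x \<in> bar_boundaries G #>\<^bsub>bar_chains G 1\<^esub> y) = (x - y \<in> bar_boundaries G)"
    using B.rcos_module[OF C.is_group assms(2,1)] assms by (simp add: bar_chains_def)
  show ?thesis
    using * C.repr_independence[OF _ assms(2) bar_boundaries_subgroup]
      C.rcos_self[OF assms(1) bar_boundaries_subgroup] by metis
qed

text \<open>Multiplicativity is, up to sign, the boundary of \<open>frag_of [g, h]\<close>.\<close>

lemma bar_class_hom: "bar_class \<in> hom G (group_homology 1 G)"
proof (rule homI)
  fix g h assume gh: "g \<in> carrier G" "h \<in> carrier G"
  interpret B: normal "bar_boundaries G" "bar_chains G 1" by (rule bar_boundaries_normal)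
  have "frag_of [g \<otimes> h] - (frag_of [g] + frag_of [h]) = bar_boundary G 2 (- frag_of [g, h])"
    using bar_boundary_diff[of G 2 0 "frag_of [g, h]"]
    by (simp only: bar_boundary_2 diff_0) (simp add: bar_boundary_def)
  also have "\<dots> \<in> bar_boundaries G"
    using gh by (intro imageI) (simp add: carrier_bar_chains)
  finally have "bar_class (g \<otimes> h) = bar_boundaries G #>\<^bsub>bar_chains G 1\<^esub> (frag_of [g] + frag_of [h])"
    unfolding bar_class_def using gh keys_add[of "frag_of [g]" "frag_of [h]"]
    by (subst bar_coset_eq_iff) (auto simp: carrier_bar_chains)
  also have "\<dots> = bar_class g <#>\<^bsub>bar_chains G 1\<^esub> bar_class h"
    using B.rcos_sum[of "frag_of [g]" "frag_of [h]"] gh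
    by (simp add: bar_class_def frag_of_in_bar_chains_1) (simp add: bar_chains_def)
  finally show "bar_class (g \<otimes> h) = bar_class g \<otimes>\<^bsub>group_homology 1 G\<^esub> bar_class h"
    by (simp add: group_homology_1 del: One_nat_def)
next
  fix g assume "g \<in> carrier G"
  then show "bar_class g \<in> carrier (group_homology 1 G)"
    by (auto simp: group_homology_1 carrier_FactGroup bar_class_def intro!: frag_of_in_bar_chains_1 simp del: One_nat_def)
qed

text \<open>The difference of the classes of \<open>g\<close> and \<open>h\<close> is the class of
  \<open>g \<otimes> inv h\<close>, so every chain is homologous to a single symbol. Thus finite
  generation passes from \<open>G\<close> to its homology.\<close>

lemma bar_class_surj: "bar_class ` carrier G = carrier (group_homology 1 G)"
proof
  interpret A: comm_group "group_homology 1 G" by (rule comm_group_homology_1)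
  interpret h: group_hom G "group_homology 1 G" bar_class
    by unfold_locales (rule bar_class_hom)
  interpret B: normal "bar_boundaries G" "bar_chains G 1" by (rule bar_boundaries_normal)
  show "bar_class ` carrier G \<subseteq> carrier (group_homology 1 G)" using h.hom_closed by blast
  have "bar_boundaries G #>\<^bsub>bar_chains G 1\<^esub> c \<in> bar_class ` carrier G"
    if "Poly_Mapping.keys c \<subseteq> {gs. length gs = 1 \<and> set gs \<subseteq> carrier G}" for c
    using that
  proof (induction rule: free_Abelian_group_induct[consumes 1, case_names zero diff of])
    case zero
    have "bar_boundaries G #>\<^bsub>bar_chains G 1\<^esub> 0 = bar_class \<one>"
      using h.hom_one B.subset by (simp add: group_homology_1 del: One_nat_def) (simp add: bar_chains_def r_coset_def)
    then show ?case by blast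
  next
    case (diff x y)
    then obtain g h where gh: "g \<in> carrier G" "h \<in> carrier G"
      "bar_boundaries G #>\<^bsub>bar_chains G 1\<^esub> x = bar_class g" "bar_boundaries G #>\<^bsub>bar_chains G 1\<^esub> y = bar_class h"
      by auto
    have xy: "x \<in> carrier (bar_chains G 1)" "y \<in> carrier (bar_chains G 1)"
      using diff by (auto simp: carrier_bar_chains)
    have inv: "inv\<^bsub>bar_chains G 1\<^esub> y = - y"
      using diff by (simp add: bar_chains_def)
    have my: "- y \<in> carrier (bar_chains G 1)" using xy by (simp add: carrier_bar_chains)
    have "bar_boundaries G #>\<^bsub>bar_chains G 1\<^esub> (x - y)
      = (bar_boundaries G #>\<^bsub>bar_chains G 1\<^esub> x) <#>\<^bsub>bar_chains G 1\<^esub> (bar_boundaries G #>\<^bsub>bar_chains G 1\<^esub> (- y))"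
      using B.rcos_sum[OF xy(1) my] by (simp add: bar_chains_def)
    also have "bar_boundaries G #>\<^bsub>bar_chains G 1\<^esub> (- y)
      = inv\<^bsub>group_homology 1 G\<^esub> (bar_boundaries G #>\<^bsub>bar_chains G 1\<^esub> y)"
      using B.inv_FactGroup[of "bar_boundaries G #>\<^bsub>bar_chains G 1\<^esub> y"] B.rcos_inv[OF xy(2)] xy
      by (simp add: group_homology_1 inv carrier_FactGroup del: One_nat_def)
    finally have "bar_boundaries G #>\<^bsub>bar_chains G 1\<^esub> (x - y) = bar_class (g \<otimes> inv h)"
      using gh by (simp add: h.hom_mult h.hom_inv del: One_nat_def) (simp add: group_homology_1 del: One_nat_def)
    then show ?case using gh(1,2) by blast
  next
    case (of gs)
    then obtain g where "gs = [g]" "g \<in> carrier G" by (auto simp: length_Suc_conv)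
    then show ?case by (auto simp: bar_class_def)
  qed
  then show "carrier (group_homology 1 G) \<subseteq> bar_class ` carrier G"
    by (auto simp: group_homology_1 carrier_FactGroup carrier_bar_chains simp del: One_nat_def)
qed

lemma finite_torsion_homology_1:
  assumes "finitely_generated G" shows "finite (torsion_subgroup (group_homology 1 G))"
proof -
  interpret A: comm_group "group_homology 1 G" by (rule comm_group_homology_1)
  interpret h: group_hom G "group_homology 1 G" bar_class
    by unfold_locales (rule bar_class_hom)
  obtain S where S: "finite S" "S \<subseteq> carrier G" "generate G S = carrier G"
    using assms by (auto simp: finitely_generated_def)
  have "generate (group_homology 1 G) (bar_class ` S) = carrier (group_homology 1 G)"
    using h.generate_img[OF S(2)] S(3) bar_class_surj by simp
  then have "finitely_generated (group_homology 1 G)"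
    using S bar_class_surj unfolding finitely_generated_def by (intro exI[of _ "bar_class ` S"]) blast
  then show ?thesis by (rule A.finite_torsion_subgroup)
qed

text \<open>A homomorphism to the integers modulo \<open>q\<close> extends linearly to the chains of degree 1 and
  vanishes modulo \<open>q\<close> on boundaries, so it separates the multiples of the class of \<open>e\<close>.\<close>

lemma T1_lower_bound:
  fixes \<phi> :: "'a \<Rightarrow> int" and q :: int and m :: nat
  assumes fg: "finitely_generated G"
    and e: "e \<in> carrier G" "n > 0" "e [^] (n::nat) = \<one>"
    and \<phi>: "\<And>g h. g \<in> carrier G \<Longrightarrow> h \<in> carrier G \<Longrightarrow> \<phi> (g \<otimes> h) mod q = (\<phi> g + \<phi> h) mod q"
    and order: "\<And>k. q dvd k * \<phi> e \<Longrightarrow> int m dvd k"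
  shows "m \<le> T1 G"
proof -
  interpret A: comm_group "group_homology 1 G" by (rule comm_group_homology_1)
  interpret h: group_hom G "group_homology 1 G" bar_class
    by unfold_locales (rule bar_class_hom)
  \<comment> \<open>The linear extension of \<open>\<phi>\<close>: a map to the free abelian group
    on the one generator \<open>()\<close>, followed by reading off the coefficient.\<close>
  define \<Psi> where "\<Psi> c = Poly_Mapping.lookup (frag_extend (\<lambda>gs. frag_cmul (\<phi> (hd gs)) (frag_of ())) c) ()"
    for c :: "'a list \<Rightarrow>\<^sub>0 int"
  have \<Psi>_diff: "\<Psi> (x - y) = \<Psi> x - \<Psi> y" for x y
    by (simp add: \<Psi>_def frag_extend_diff lookup_minus)
  have \<Psi>_add: "\<Psi> (x + y) = \<Psi> x + \<Psi> y" for x y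
    by (simp add: \<Psi>_def frag_extend_add lookup_add)
  have \<Psi>_of: "\<Psi> (frag_of [g]) = \<phi> g" for g
    by (simp add: \<Psi>_def)
  have \<Psi>_bd: "q dvd \<Psi> (bar_boundary G 2 c)" if "c \<in> carrier (bar_chains G 2)" for c
  proof -
    have "Poly_Mapping.keys c \<subseteq> {gs. length gs = 2 \<and> set gs \<subseteq> carrier G}"
      using that by (simp add: carrier_bar_chains)
    then show ?thesis
    proof (induction rule: free_Abelian_group_induct[consumes 1, case_names zero diff of])
      case zero then show ?case by (simp add: bar_boundary_def \<Psi>_def)
    next
      case (diff x y) then show ?case by (simp add: bar_boundary_diff \<Psi>_diff)
    next
      case (of gs)
      then obtain g h where gs: "gs = [g, h]" "g \<in> carrier G" "h \<in> carrier G"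
        using bar_2_cases by blast
      have "q dvd \<phi> (g \<otimes> h) - (\<phi> g + \<phi> h)" using \<phi>[OF gs(2,3)] by (simp add: mod_eq_dvd_iff)
      then have "q dvd - (\<phi> (g \<otimes> h) - (\<phi> g + \<phi> h))" by (simp only: dvd_minus_iff)
      then show ?case by (simp add: gs(1) bar_boundary_2 \<Psi>_diff \<Psi>_add \<Psi>_of algebra_simps)
    qed
  qed
  have \<phi>_pow: "\<phi> (e [^] k) mod q = (int k * \<phi> e) mod q" for k :: nat
  proof (induction k)
    case 0
    have "\<phi> \<one> mod q = (\<phi> \<one> + \<phi> \<one>) mod q" using \<phi>[of \<one> \<one>] by simp
    then show ?case by (simp add: mod_eq_dvd_iff)
  next
    case (Suc k)
    have "\<phi> (e [^] Suc k) mod q = (\<phi> (e [^] k) + \<phi> e) mod q" using \<phi>[of "e [^] k" e] e by simp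
    also have "\<dots> = (int k * \<phi> e + \<phi> e) mod q" using Suc by (intro mod_add_cong) auto
    finally show ?case by (simp add: algebra_simps)
  qed
  \<comment> \<open>If two of these powers had the same class, \<open>q\<close> would divide
    \<open>(k - l) * \<phi> e\<close>, and \<open>order\<close> would force \<open>k\<close> and
    \<open>l\<close> to agree modulo \<open>m\<close>.\<close>
  have "inj_on (\<lambda>k. bar_class (e [^] (k::nat))) {..<m}"
  proof (rule inj_onI)
    fix k l assume kl: "k \<in> {..<m}" "l \<in> {..<m}" "bar_class (e [^] k) = bar_class (e [^] l)"
    then have "frag_of [e [^] k] - frag_of [e [^] l] \<in> bar_boundaries G"
      unfolding bar_class_def using e by (subst (asm) bar_coset_eq_iff) (auto intro!: frag_of_in_bar_chains_1 simp del: One_nat_def)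
    then have "q dvd \<Psi> (frag_of [e [^] k] - frag_of [e [^] l])" using \<Psi>_bd by auto
    then have "\<phi> (e [^] k) mod q = \<phi> (e [^] l) mod q" by (simp add: \<Psi>_diff \<Psi>_of mod_eq_dvd_iff)
    then have "(int k * \<phi> e) mod q = (int l * \<phi> e) mod q" by (simp only: \<phi>_pow)
    then have "q dvd (int k - int l) * \<phi> e" by (simp add: mod_eq_dvd_iff left_diff_distrib)
    then have "int m dvd int k - int l" by (rule order)
    then have "int k mod int m = int l mod int m" by (simp add: mod_eq_dvd_iff)
    then show "k = l" using kl by simp
  qed
  moreover have "(\<lambda>k. bar_class (e [^] (k::nat))) ` {..<m} \<subseteq> torsion_subgroup (group_homology 1 G)"
  proof clarify
    fix k :: nat
    have "bar_class (e [^] k) [^]\<^bsub>group_homology 1 G\<^esub> n = bar_class ((e [^] k) [^] n)"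
      using e by (simp add: h.hom_nat_pow)
    also have "(e [^] k) [^] n = \<one>" using e by (metis nat_pow_one nat_pow_pow mult.commute)
    finally show "bar_class (e [^] k) \<in> torsion_subgroup (group_homology 1 G)"
      using e h.hom_closed[of "e [^] k"] by (auto simp: torsion_subgroup_def simp del: One_nat_def intro!: exI[of _ n])
  qed
  ultimately show ?thesis
    unfolding T1_def using card_inj_on_le[OF _ _ finite_torsion_homology_1[OF fg]] by force
qed

text \<open>Finite index enters through Schreier's lemma: \<open>M\<close> inherits finite
  generation, which makes the torsion of its homology finite.\<close>

lemma T1_subgroup_lower_bound:
  fixes \<phi> :: "'a \<Rightarrow> int" and q :: int and m :: nat
  assumes fg: "finitely_generated G" and M: "subgroup M G" "finite_index G M"
    and e: "e \<in> M" "n > 0" "e [^] (n::nat) = \<one>"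
    and \<phi>: "\<And>g h. g \<in> M \<Longrightarrow> h \<in> M \<Longrightarrow> \<phi> (g \<otimes> h) mod q = (\<phi> g + \<phi> h) mod q"
    and order: "\<And>k. q dvd k * \<phi> e \<Longrightarrow> int m dvd k"
  shows "m \<le> T1 (G\<lparr>carrier := M\<rparr>)"
proof -
  interpret M: group "G\<lparr>carrier := M\<rparr>" using M(1) by (rule subgroup_imp_group)
  obtain S where S: "finite S" "S \<subseteq> carrier G" "generate G S = carrier G"
    using fg by (auto simp: finitely_generated_def)
  obtain T where T: "finite T" "T \<subseteq> M" "generate G T = M"
    using subgroup_finitely_generated[OF S M(1)] M(2) by (auto simp: finite_index_def)
  then have "finitely_generated (G\<lparr>carrier := M\<rparr>)"
    using generate_consistent[OF T(2) M(1)] by (auto simp: finitely_generated_def)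
  moreover have "e [^]\<^bsub>G\<lparr>carrier := M\<rparr>\<^esub> n = \<one>\<^bsub>G\<lparr>carrier := M\<rparr>\<^esub>"
    using e by (simp flip: nat_pow_consistent)
  ultimately show ?thesis
    using e \<phi> order by (intro M.T1_lower_bound[where e = e and n = n and \<phi> = \<phi> and q = q]) auto
qed

end

section \<open>Permutational wreath products with varying base\<close>

lemma int_eq_0_of_mod_add_eq:
  fixes a b k :: int
  assumes "(a + b) mod k = b" "0 \<le> a" "a < k"
  shows "a = 0"
proof -
  have "(a + b) mod k = b mod k" using assms by (metis mod_mod_trivial)
  then have "k dvd a" by (simp add: mod_eq_dvd_iff)
  then show ?thesis using assms(2,3) zdvd_imp_le[of k a] by linarith
qed

text \<open>\<open>F\<close> is any invariant with finitely many values that separates the cosets;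
  equal values force equal cosets, so the coset is a function of the value.\<close>

lemma (in group) subgroup_index_le:
  assumes M: "subgroup M G" and "finite B" "\<And>x. x \<in> carrier G \<Longrightarrow> F x \<in> B"
    and sep: "\<And>x y. \<lbrakk>x \<in> carrier G; y \<in> carrier G; F x = F y\<rbrakk> \<Longrightarrow> x \<otimes> inv y \<in> M"
  shows "finite_index G M" "subgroup_index G M \<le> card B"
proof -
  interpret M: subgroup M G by fact
  define p where "p b = M #> (SOME x. x \<in> carrier G \<and> F x = b)" for b
  have "M #> x = p (F x)" if x: "x \<in> carrier G" for x
  proof -
    define y where "y = (SOME y. y \<in> carrier G \<and> F y = F x)"
    have y: "y \<in> carrier G" "F y = F x"
      using someI[of "\<lambda>y. y \<in> carrier G \<and> F y = F x" x] x by (auto simp: y_def)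
    then have "y \<otimes> inv x \<in> M" using sep x by simp
    then have "y \<in> M #> x" using x y by (intro M.rcos_module_rev) auto
    then show ?thesis using repr_independence[OF _ x M] by (simp add: p_def y_def)
  qed
  then have "rcosets M \<subseteq> p ` B" using assms(3) by (auto simp: RCOSETS_def)
  then show "finite_index G M" "subgroup_index G M \<le> card B"
    using \<open>finite B\<close> finite_subset[of _ "p ` B"] surj_card_le[of B]
    by (auto simp: finite_index_def subgroup_index_def)
qed

text \<open>As \<open>N i\<close> is normal and contained in \<open>U i\<close>, it acts trivially
  on the coset space of \<open>U i\<close>.\<close>

locale coset_tower = group \<Gamma> for \<Gamma> :: "('g, 'm) monoid_scheme" (structure) +
  fixes N U :: "nat \<Rightarrow> 'g set" and q :: "nat \<Rightarrow> nat"
  assumes N_normal: "N i \<lhd> \<Gamma>"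
    and N_finite_index: "finite (rcosets N i)"
    and N_Suc: "N (Suc i) \<subseteq> N i"
    and N_Inter: "(\<Inter>i. N i) = {\<one>}"
    and U_subgroup: "subgroup (U i) \<Gamma>"
    and N_U: "N i \<subseteq> U i"
    and q_pos: "q i > 0"
begin

text \<open>The semidirect product of \<open>\<Gamma>\<close> with the product over \<open>j\<close> of the permutation modules of
  functions from \<open>\<Gamma> / U j\<close> to the integers modulo \<open>q j\<close>. Such a function is represented by a
  right \<open>U j\<close>-invariant function on \<open>\<Gamma>\<close>, extended by \<open>0\<close> outside the carrier.\<close>

definition wreath :: "((nat \<Rightarrow> 'g \<Rightarrow> int) \<times> 'g) monoid" where
  "wreath = \<lparr>carrier = {(a, g). g \<in> carrier \<Gamma> \<and> (\<forall>j x. a j x \<in> {0..<int (q j)}) \<and>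
      (\<forall>j x. x \<notin> carrier \<Gamma> \<longrightarrow> a j x = 0) \<and>
      (\<forall>j. \<forall>x\<in>carrier \<Gamma>. \<forall>u\<in>U j. a j (x \<otimes> u) = a j x)},
    monoid.mult = (\<lambda>(a, g) (b, h). (\<lambda>j x. if x \<in> carrier \<Gamma> then (a j x + b j (inv g \<otimes> x)) mod int (q j) else 0,
      g \<otimes> h)),
    one = (\<lambda>_ _. 0, \<one>)\<rparr>"

text \<open>The delta function at the trivial coset. The reduction modulo \<open>q j\<close> makes
  it a legal value, namely 0, when \<open>q j = 1\<close>.\<close>

definition base_unit :: "nat \<Rightarrow> 'g \<Rightarrow> int" where
  "base_unit j x = (if x \<in> U j then 1 mod int (q j) else 0)"

lemma N_subgroup: "subgroup (N i) \<Gamma>"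
  using N_normal normal_imp_subgroup by blast

lemma N_carrier: "n \<in> N i \<Longrightarrow> n \<in> carrier \<Gamma>"
  using N_subgroup subgroup.subset by blast

lemma U_carrier: "u \<in> U i \<Longrightarrow> u \<in> carrier \<Gamma>"
  using U_subgroup subgroup.subset by blast

lemma N_mono: "i \<le> j \<Longrightarrow> N j \<subseteq> N i"
  using N_Suc by (rule lift_Suc_antimono_le)

lemma wreath_group: "group wreath"
proof (rule groupI)
  fix x y assume xy: "x \<in> carrier wreath" "y \<in> carrier wreath"
  obtain a g b h where [simp]: "x = (a, g)" "y = (b, h)" by (cases x, cases y) auto
  have U: "b j (inv g \<otimes> (z \<otimes> u)) = b j (inv g \<otimes> z)" if "z \<in> carrier \<Gamma>" "u \<in> U j" for j z u
    using xy that U_carrier[of u j] by (auto simp: wreath_def m_assoc[symmetric])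
  show "x \<otimes>\<^bsub>wreath\<^esub> y \<in> carrier wreath"
    using xy U U_carrier q_pos by (auto simp: wreath_def)
next
  show "\<one>\<^bsub>wreath\<^esub> \<in> carrier wreath" using q_pos by (auto simp: wreath_def)
next
  fix x y z assume xyz: "x \<in> carrier wreath" "y \<in> carrier wreath" "z \<in> carrier wreath"
  obtain a g b h c k where [simp]: "x = (a, g)" "y = (b, h)" "z = (c, k)"
    by (cases x, cases y, cases z) auto
  show "x \<otimes>\<^bsub>wreath\<^esub> y \<otimes>\<^bsub>wreath\<^esub> z = x \<otimes>\<^bsub>wreath\<^esub> (y \<otimes>\<^bsub>wreath\<^esub> z)"
    using xyz by (auto simp: wreath_def fun_eq_iff m_assoc inv_mult_group mod_simps add.assoc)
next
  fix x assume x: "x \<in> carrier wreath"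
  obtain a g where [simp]: "x = (a, g)" by (cases x) auto
  show "\<one>\<^bsub>wreath\<^esub> \<otimes>\<^bsub>wreath\<^esub> x = x"
    using x by (auto simp: wreath_def fun_eq_iff)
  define b where "b j z = (if z \<in> carrier \<Gamma> then (- a j (g \<otimes> z)) mod int (q j) else 0)" for j z
  have U: "a j (g \<otimes> (z \<otimes> u)) = a j (g \<otimes> z)" if "z \<in> carrier \<Gamma>" "u \<in> U j" for j z u
    using x that U_carrier[of u j] by (auto simp: wreath_def m_assoc[symmetric])
  have "(b, inv g) \<in> carrier wreath"
    using x U U_carrier q_pos by (auto simp: wreath_def b_def)
  moreover have "(b, inv g) \<otimes>\<^bsub>wreath\<^esub> x = \<one>\<^bsub>wreath\<^esub>"
    using x by (auto simp: wreath_def b_def fun_eq_iff mod_simps)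
  ultimately show "\<exists>y\<in>carrier wreath. y \<otimes>\<^bsub>wreath\<^esub> x = \<one>\<^bsub>wreath\<^esub>" by blast
qed

lemma snd_hom: "snd \<in> hom wreath \<Gamma>"
  by (auto simp: hom_def wreath_def)

lemma base_unit_in_wreath: "(base_unit, \<one>) \<in> carrier wreath"
proof -
  have "(x \<otimes> u \<in> U j) = (x \<in> U j)" if xu: "x \<in> carrier \<Gamma>" "u \<in> U j" for x u j
  proof -
    interpret U: subgroup "U j" \<Gamma> by (rule U_subgroup)
    have "x = x \<otimes> u \<otimes> inv u" using xu by (simp add: m_assoc)
    then show ?thesis using xu by (metis U.m_closed U.m_inv_closed)
  qed
  then show ?thesis using q_pos U_carrier by (auto simp: wreath_def base_unit_def)
qed

lemma top_in_wreath: "g \<in> carrier \<Gamma> \<Longrightarrow> (\<lambda>_ _. 0, g) \<in> carrier wreath"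
  using q_pos by (auto simp: wreath_def)

lemma top_embedding_hom: "(\<lambda>g. (\<lambda>_ _. 0, g)) \<in> hom \<Gamma> wreath"
  using q_pos by (auto simp: hom_def wreath_def fun_eq_iff)

end

text \<open>Working with an embedding instead of a subgroup leaves the type of \<open>H\<close> free.\<close>

locale embedded_group = coset_tower \<Gamma> N U q + H: group H
  for \<Gamma> :: "('g, 'm) monoid_scheme" (structure) and N U q and H :: "('h, 'k) monoid_scheme" +
  fixes emb :: "'h \<Rightarrow> (nat \<Rightarrow> 'g \<Rightarrow> int) \<times> 'g"
  assumes emb_hom: "emb \<in> hom H wreath"
    and emb_inj: "inj_on emb (carrier H)"
    and base_unit_in_emb: "(base_unit, \<one>) \<in> emb ` carrier H"
    and top_in_emb: "g \<in> carrier \<Gamma> \<Longrightarrow> (\<lambda>_ _. 0, g) \<in> emb ` carrier H"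
begin

definition base :: "'h \<Rightarrow> nat \<Rightarrow> 'g \<Rightarrow> int" where "base z = fst (emb z)"

definition proj :: "'h \<Rightarrow> 'g" where "proj z = snd (emb z)"

lemma emb_closed: "z \<in> carrier H \<Longrightarrow> emb z \<in> carrier wreath"
  using emb_hom by (rule hom_in_carrier)

lemma emb_mult: "z \<in> carrier H \<Longrightarrow> w \<in> carrier H \<Longrightarrow> emb (z \<otimes>\<^bsub>H\<^esub> w) = emb z \<otimes>\<^bsub>wreath\<^esub> emb w"
  using emb_hom by (rule hom_mult)

lemma proj_is_hom: "group_hom H \<Gamma> proj"
proof unfold_locales
  have "snd \<circ> emb \<in> hom H \<Gamma>"
    using emb_hom snd_hom by (rule Group.hom_compose)
  then show "proj \<in> hom H \<Gamma>" by (simp add: comp_def proj_def[abs_def])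
qed

sublocale proj: group_hom H \<Gamma> proj by (rule proj_is_hom)

lemma base_range: "z \<in> carrier H \<Longrightarrow> 0 \<le> base z j x" "z \<in> carrier H \<Longrightarrow> base z j x < int (q j)"
  using emb_closed[of z] by (auto simp: wreath_def base_def)

lemma base_outside: "z \<in> carrier H \<Longrightarrow> x \<notin> carrier \<Gamma> \<Longrightarrow> base z j x = 0"
  using emb_closed[of z] by (auto simp: wreath_def base_def)

lemma base_U: "z \<in> carrier H \<Longrightarrow> x \<in> carrier \<Gamma> \<Longrightarrow> u \<in> U j \<Longrightarrow> base z j (x \<otimes> u) = base z j x"
  using emb_closed[of z] by (auto simp: wreath_def base_def)

lemma base_mult:
  "\<lbrakk>z \<in> carrier H; w \<in> carrier H; x \<in> carrier \<Gamma>\<rbrakk> \<Longrightarrow>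
    base (z \<otimes>\<^bsub>H\<^esub> w) j x = (base z j x + base w j (inv (proj z) \<otimes> x)) mod int (q j)"
  by (simp add: base_def proj_def emb_mult) (simp add: wreath_def case_prod_beta)

lemma emb_one: "emb \<one>\<^bsub>H\<^esub> = (\<lambda>_ _. 0, \<one>)"
  using hom_one[OF emb_hom H.is_group wreath_group] by (simp add: wreath_def)

lemma base_one: "base \<one>\<^bsub>H\<^esub> j x = 0"
  by (simp add: base_def emb_one)

lemma emb_eqI:
  assumes "z \<in> carrier H" "w \<in> carrier H" "proj z = proj w"
    and "\<And>j x. x \<in> carrier \<Gamma> \<Longrightarrow> base z j x = base w j x"
  shows "z = w"
proof -
  have "base z j x = base w j x" for j x
    using assms by (cases "x \<in> carrier \<Gamma>") (auto simp: base_outside)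
  then have "emb z = emb w" using assms(3) by (intro prod_eqI) (auto simp: base_def proj_def)
  then show ?thesis using emb_inj assms by (auto dest: inj_onD)
qed

text \<open>Left translation by \<open>n\<close> is right translation by a conjugate of
  \<open>n\<close>, which lies in \<open>N j\<close> and so in \<open>U j\<close>.\<close>

lemma base_N:
  assumes "z \<in> carrier H" "n \<in> N j" "x \<in> carrier \<Gamma>"
  shows "base z j (n \<otimes> x) = base z j x"
proof -
  interpret N: normal "N j" \<Gamma> by (rule N_normal)
  have "inv x \<otimes> n \<otimes> x \<in> U j" using assms N.inv_op_closed1 N_U by blast
  moreover have "n \<otimes> x = x \<otimes> (inv x \<otimes> n \<otimes> x)"
    using assms N_carrier by (simp add: m_assoc[symmetric])
  ultimately show ?thesis using assms base_U by simp
qed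

text \<open>Over \<open>N j\<close> the twist by \<open>proj y\<close> disappears. This is what
  later makes evaluation of a component a homomorphism.\<close>

lemma base_mult_N:
  assumes "y \<in> carrier H" "w \<in> carrier H" "proj y \<in> N j" "x \<in> carrier \<Gamma>"
  shows "base (y \<otimes>\<^bsub>H\<^esub> w) j x = (base y j x + base w j x) mod int (q j)"
  using assms base_mult base_N subgroup.m_inv_closed[OF N_subgroup] by simp

text \<open>The strict bound \<open>j<i\<close> leaves component \<open>i\<close> free: there the
  torsion is detected.\<close>

definition M :: "nat \<Rightarrow> 'h set" where
  "M i = {z \<in> carrier H. proj z \<in> N i \<and> (\<forall>j<i. \<forall>x\<in>carrier \<Gamma>. base z j x = 0)}"

lemma base_mult_M:
  assumes "y \<in> carrier H" "w \<in> carrier H" "proj y \<in> N i" "x \<in> carrier \<Gamma>" "j \<le> i"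
  shows "base (y \<otimes>\<^bsub>H\<^esub> w) j x = (base y j x + base w j x) mod int (q j)"
  using assms N_mono[of j i] by (intro base_mult_N) auto

text \<open>Over \<open>N i\<close> the components of \<open>y\<close> before \<open>i\<close> are
  simply added to those of \<open>w\<close>, so they are 0 if \<open>w\<close> does not change.
  Choosing \<open>w\<close> well avoids computing the components of inverses and conjugates.\<close>

lemma in_M_if_base_eq:
  assumes "y \<in> carrier H" "w \<in> carrier H" "proj y \<in> N i"
    and "\<And>j x. j < i \<Longrightarrow> x \<in> carrier \<Gamma> \<Longrightarrow> base (y \<otimes>\<^bsub>H\<^esub> w) j x = base w j x"
  shows "y \<in> M i"
proof -
  have "base y j x = 0" if "j < i" "x \<in> carrier \<Gamma>" for j x
    using base_mult_M[OF assms(1,2,3) that(2), of j] assms(4)[OF that] that base_range[OF assms(1)]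
    by (intro int_eq_0_of_mod_add_eq[of _ "base w j x" "int (q j)"]) auto
  then show ?thesis using assms by (simp add: M_def)
qed

lemma M_subgroup: "subgroup (M i) H"
proof (rule H.subgroupI)
  show "M i \<subseteq> carrier H" by (auto simp: M_def)
  have "\<one>\<^bsub>H\<^esub> \<in> M i" using subgroup.one_closed[OF N_subgroup] by (simp add: M_def base_one)
  then show "M i \<noteq> {}" by auto
  fix y assume y: "y \<in> M i"
  then have yc: "y \<in> carrier H" by (simp add: M_def)
  show "inv\<^bsub>H\<^esub> y \<in> M i"
    using y yc subgroup.m_inv_closed[OF N_subgroup]
    by (intro in_M_if_base_eq[of _ y]) (auto simp: M_def base_one)
  fix w assume w: "w \<in> M i"
  show "y \<otimes>\<^bsub>H\<^esub> w \<in> M i"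
    using y w subgroup.m_closed[OF N_subgroup] base_mult_M[of y w i] by (auto simp: M_def)
qed

lemma M_normal: "M i \<lhd> H"
  unfolding H.normal_inv_iff
proof (intro conjI ballI M_subgroup)
  interpret N: normal "N i" \<Gamma> by (rule N_normal)
  fix g y assume gy: "g \<in> carrier H" "y \<in> M i"
  then have yc: "y \<in> carrier H" by (simp add: M_def)
  show "g \<otimes>\<^bsub>H\<^esub> y \<otimes>\<^bsub>H\<^esub> inv\<^bsub>H\<^esub> g \<in> M i"
  proof (rule in_M_if_base_eq)
    show "proj (g \<otimes>\<^bsub>H\<^esub> y \<otimes>\<^bsub>H\<^esub> inv\<^bsub>H\<^esub> g) \<in> N i"
      using gy yc N.inv_op_closed2 by (simp add: M_def)
    fix j x assume "j < i" "x \<in> carrier \<Gamma>"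
    \<comment> \<open>The conjugate times \<open>g\<close> is the product of \<open>g\<close> and
      \<open>y\<close>, and \<open>y\<close> contributes nothing to the components before
      \<open>i\<close>.\<close>
    then have "base (g \<otimes>\<^bsub>H\<^esub> y) j x = base g j x"
      using gy yc base_mult[of g y x j] base_range[of g j x] by (simp add: M_def)
    then show "base (g \<otimes>\<^bsub>H\<^esub> y \<otimes>\<^bsub>H\<^esub> inv\<^bsub>H\<^esub> g \<otimes>\<^bsub>H\<^esub> g) j x = base g j x"
      using gy yc by (simp add: H.m_assoc)
  qed (use gy yc in auto)
qed

lemma M_Suc: "M (Suc i) \<subseteq> M i"
  using N_Suc[of i] by (auto simp: M_def)

lemma M_Inter: "(\<Inter>i. M i) = {\<one>\<^bsub>H\<^esub>}"
proof
  show "{\<one>\<^bsub>H\<^esub>} \<subseteq> (\<Inter>i. M i)" using subgroup.one_closed[OF M_subgroup] by auto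
  show "(\<Inter>i. M i) \<subseteq> {\<one>\<^bsub>H\<^esub>}"
  proof
    fix z assume z: "z \<in> (\<Inter>i. M i)"
    then have zc: "z \<in> carrier H" by (auto simp: M_def)
    have "proj z \<in> (\<Inter>i. N i)" using z by (auto simp: M_def)
    then have "proj z = \<one>" using N_Inter by auto
    moreover have "base z j x = 0" if "x \<in> carrier \<Gamma>" for j x
      using z that by (auto simp: M_def)
    ultimately have "z = \<one>\<^bsub>H\<^esub>"
      using zc by (intro emb_eqI) (auto simp: base_one)
    then show "z \<in> {\<one>\<^bsub>H\<^esub>}" by simp
  qed
qed

text \<open>Modulo \<open>M i\<close> an element is determined by the \<open>N i\<close>-coset of
  its projection and by its components before \<open>i\<close>, which are constant on cosets of
  \<open>N i\<close>. The bound does not involve \<open>q i\<close>, so \<open>q i\<close> can be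
  chosen after it.\<close>

lemma M_index:
  assumes R: "\<And>j. j < i \<Longrightarrow> q j \<le> R"
  shows "finite_index H (M i)"
    "subgroup_index H (M i) \<le> card (rcosets N i) * R ^ (i * card (rcosets N i))"
proof -
  interpret N: subgroup "N i" \<Gamma> by (rule N_subgroup)
  define I where "I = {..<i} \<times> (rcosets N i)"
  define B where "B = (rcosets N i) \<times> (I \<rightarrow>\<^sub>E {0..<int R})"
  define F where "F z = (N i #> proj z, \<lambda>p\<in>I. base z (fst p) (SOME x. x \<in> snd p))" for z
  have fin: "finite I" "finite B" using N_finite_index by (auto simp: I_def B_def intro!: finite_PiE)
  have FB: "F z \<in> B" if z: "z \<in> carrier H" for z
  proof -
    have "base z j x < int R" if "j < i" for j x
      using base_range(2)[OF z, of j x] R[OF that] by linarith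
    then show ?thesis
      using z base_range[OF z] rcosetsI[OF N.subset proj.hom_closed[OF z]]
      by (auto simp: F_def B_def I_def)
  qed
  have sep: "z \<otimes>\<^bsub>H\<^esub> inv\<^bsub>H\<^esub> w \<in> M i" if zw: "z \<in> carrier H" "w \<in> carrier H" "F z = F w" for z w
  proof (rule in_M_if_base_eq[of _ w])
    have "proj z \<in> N i #> proj w"
      using zw rcos_self[OF proj.hom_closed N_subgroup] by (auto simp: F_def)
    then show "proj (z \<otimes>\<^bsub>H\<^esub> inv\<^bsub>H\<^esub> w) \<in> N i"
      using zw N.rcos_module_imp[OF is_group, of "proj w" "proj z"] by simp
    fix j x assume jx: "j < i" "x \<in> carrier \<Gamma>"
    define r where "r = (SOME y. y \<in> N i #> x)"
    have "r \<in> N i #> x" unfolding r_def using rcos_self[OF jx(2) N_subgroup] by (rule someI)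
    then obtain n where n: "n \<in> N i" "r = n \<otimes> x" by (auto simp: r_coset_def)
    have "n \<in> N j" using n(1) N_mono[of j i] jx by auto
    then have r: "base y j x = base y j r" if "y \<in> carrier H" for y
      using base_N[OF that, of n j x] jx n by simp
    have p: "(j, N i #> x) \<in> I" using jx rcosetsI[OF N.subset] by (auto simp: I_def)
    have "snd (F z) (j, N i #> x) = snd (F w) (j, N i #> x)" using zw by simp
    then have "base z j r = base w j r" using p by (simp add: F_def r_def)
    then have "base z j x = base w j x" using r zw by simp
    then show "base (z \<otimes>\<^bsub>H\<^esub> inv\<^bsub>H\<^esub> w \<otimes>\<^bsub>H\<^esub> w) j x = base w j x"
      using zw by (simp add: H.m_assoc)
  qed (use zw in auto)
  show "finite_index H (M i)" using H.subgroup_index_le(1)[OF M_subgroup fin(2) FB sep] .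
  have "subgroup_index H (M i) \<le> card B" using H.subgroup_index_le(2)[OF M_subgroup fin(2) FB sep] .
  also have "card B = card (rcosets N i) * R ^ (i * card (rcosets N i))"
    using fin by (simp add: B_def card_cartesian_product card_PiE I_def)
  finally show "subgroup_index H (M i) \<le> card (rcosets N i) * R ^ (i * card (rcosets N i))" .
qed

section \<open>The abelian kernel of the projection\<close>

definition A :: "'h set" where "A = kernel H \<Gamma> proj"

lemma in_A_iff: "z \<in> A \<longleftrightarrow> z \<in> carrier H \<and> proj z = \<one>"
  by (auto simp: A_def kernel_def)

lemma A_normal: "A \<lhd> H"
  unfolding A_def by (rule proj.normal_kernel)

lemma base_mult_A:
  assumes "y \<in> A" "w \<in> carrier H" "x \<in> carrier \<Gamma>"
  shows "base (y \<otimes>\<^bsub>H\<^esub> w) j x = (base y j x + base w j x) mod int (q j)"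
  using assms subgroup.one_closed[OF N_subgroup] by (intro base_mult_N) (auto simp: in_A_iff)

lemma A_commute: "y \<in> A \<Longrightarrow> w \<in> A \<Longrightarrow> y \<otimes>\<^bsub>H\<^esub> w = w \<otimes>\<^bsub>H\<^esub> y"
  by (rule emb_eqI) (auto simp: in_A_iff base_mult_A add.commute)

lemma A_comm_group: "comm_group (H\<lparr>carrier := A\<rparr>)"
  using H.subgroup_imp_group[OF normal_imp_subgroup[OF A_normal]] A_commute
  by (intro group.group_comm_groupI) auto

lemma obtain_lift:
  assumes "g \<in> carrier \<Gamma>"
  obtains z where "z \<in> carrier H" "proj z = g" "\<And>j x. base z j x = 0"
  using top_in_emb[OF assms] by (auto simp: base_def proj_def) (metis fst_conv snd_conv)

lemma quotient_iso: "H Mod A \<cong> \<Gamma>"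
proof -
  have "proj ` carrier H = carrier \<Gamma>"
    using obtain_lift proj.hom_closed by (metis (no_types, lifting) image_eqI image_subsetI subsetI subset_antisym)
  then show ?thesis unfolding A_def by (rule proj.FactGroup_iso)
qed

lemma base_pow:
  assumes "z \<in> A" "x \<in> carrier \<Gamma>"
  shows "base (z [^]\<^bsub>H\<^esub> (k::nat)) j x = (int k * base z j x) mod int (q j)"
proof (induction k)
  case 0 then show ?case by (simp add: base_one)
next
  case (Suc k)
  have "z [^]\<^bsub>H\<^esub> k \<in> A" using assms by (simp add: in_A_iff proj.hom_nat_pow)
  then have "base (z [^]\<^bsub>H\<^esub> Suc k) j x = (int k * base z j x + base z j x) mod int (q j)"
    using assms Suc by (simp add: base_mult_A in_A_iff mod_simps)
  then show ?case by (simp add: algebra_simps)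
qed

end

section \<open>Countable models\<close>

text \<open>Words over \<open>S\<close> and its inverses form a countable set that maps onto the
  generated subgroup.\<close>

lemma (in group) countable_generate:
  assumes "countable S" "S \<subseteq> carrier G" shows "countable (generate G S)"
proof -
  define T where "T = S \<union> m_inv G ` S"
  have T: "countable T" "T \<subseteq> carrier G" using assms by (auto simp: T_def)
  have closed: "foldr (\<otimes>) xs \<one> \<in> carrier G" if "xs \<in> lists T" for xs
    using that T by induction auto
  have append: "foldr (\<otimes>) (xs @ ys) \<one> = foldr (\<otimes>) xs \<one> \<otimes> foldr (\<otimes>) ys \<one>"
    if "xs \<in> lists T" "ys \<in> lists T" for xs ys
    using that(1)
  proof induction
    case Nil then show ?case using closed[OF that(2)] by simp
  next
    case (Cons x xs)
    then show ?case using closed[OF that(2)] closed[of xs] T by (auto simp: m_assoc subset_iff)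
  qed
  have "x \<in> (\<lambda>xs. foldr (\<otimes>) xs \<one>) ` lists T" if "x \<in> generate G S" for x
    using that
  proof (induction rule: generate.induct)
    case one show ?case by (rule image_eqI[of _ _ "[]"]) auto
  next
    case (incl h) then show ?case using assms by (intro image_eqI[of _ _ "[h]"]) (auto simp: T_def)
  next
    case (inv h) then show ?case using assms by (intro image_eqI[of _ _ "[inv h]"]) (auto simp: T_def)
  next
    case (eng g h)
    then obtain xs ys where xy: "xs \<in> lists T" "ys \<in> lists T" "g = foldr (\<otimes>) xs \<one>" "h = foldr (\<otimes>) ys \<one>"
      by auto
    then have "g \<otimes> h = foldr (\<otimes>) (xs @ ys) \<one>" using append by simp
    then show ?case using xy(1,2) by (intro image_eqI[of _ _ "xs @ ys"]) auto
  qed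
  then have "generate G S \<subseteq> (\<lambda>xs. foldr (\<otimes>) xs \<one>) ` lists T" by blast
  then show ?thesis using T by (meson countable_image countable_lists countable_subset)
qed

text \<open>The generated subgroup is countable, so its multiplication can be transported to natural
  numbers along an enumeration; \<open>emb\<close> is the decoding.\<close>

lemma (in group) finitely_generated_nat_model:
  assumes S: "finite S" "S \<subseteq> carrier G"
  obtains H :: "nat monoid" and emb where "group H" "finitely_generated H"
    "emb \<in> hom H G" "inj_on emb (carrier H)" "emb ` carrier H = generate G S"
proof -
  let ?K = "generate G S"
  interpret K: subgroup ?K G using S by (intro generate_is_subgroup)
  define enc where "enc = to_nat_on ?K"
  define emb where "emb = from_nat_into ?K"
  have cK: "countable ?K" using S by (intro countable_generate countable_finite)
  have emb_enc: "emb (enc x) = x" if "x \<in> ?K" for x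
    using that cK by (simp add: emb_def enc_def)
  define H where "H = \<lparr>carrier = enc ` ?K, monoid.mult = (\<lambda>x y. enc (emb x \<otimes> emb y)), one = enc \<one>\<rparr>"
  have "group H"
  proof (rule groupI)
    fix x assume "x \<in> carrier H"
    then obtain k where "k \<in> ?K" "x = enc k" by (auto simp: H_def)
    then show "\<exists>y\<in>carrier H. y \<otimes>\<^bsub>H\<^esub> x = \<one>\<^bsub>H\<^esub>"
      by (intro bexI[of _ "enc (inv k)"]) (auto simp: H_def emb_enc)
  qed (auto simp: H_def emb_enc m_assoc)
  have hom: "emb \<in> hom H G" by (auto simp: hom_def H_def emb_enc)
  have inj: "inj_on emb (carrier H)" by (auto simp: inj_on_def H_def emb_enc)
  have img: "emb ` carrier H = ?K" using emb_enc by (force simp: H_def)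
  interpret H: group H by fact
  interpret emb: group_hom H G emb using hom by unfold_locales
  have SK: "S \<subseteq> ?K" by (auto intro: generate.incl)
  have eS: "enc ` S \<subseteq> carrier H" using SK by (auto simp: H_def)
  have "emb ` (enc ` S) = S" using SK emb_enc by force
  then have "emb ` generate H (enc ` S) = emb ` carrier H" using emb.generate_img[OF eS] img by simp
  then have "generate H (enc ` S) = carrier H"
    using inj H.generate_incl[OF eS] by (metis inj_on_image_eq_iff subset_refl)
  then have "finitely_generated H" using S eS unfolding finitely_generated_def by blast
  then show thesis using that \<open>group H\<close> hom inj img by blast
qed

text \<open>\<open>H\<close> is a copy of the subgroup generated by
  \<open>(base_unit, \<one>)\<close> and the generators of \<open>\<Gamma>\<close>.\<close>

lemma (in coset_tower) embedded_group_exists: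
  assumes "finitely_generated \<Gamma>"
  obtains H :: "nat monoid" and emb where "embedded_group \<Gamma> N U q H emb" "finitely_generated H"
proof -
  interpret W: group wreath by (rule wreath_group)
  interpret i: group_hom \<Gamma> wreath "\<lambda>g. (\<lambda>_ _. 0, g)"
    using top_embedding_hom by unfold_locales
  obtain S where S: "finite S" "S \<subseteq> carrier \<Gamma>" "generate \<Gamma> S = carrier \<Gamma>"
    using assms by (auto simp: finitely_generated_def)
  let ?i = "\<lambda>g. (\<lambda>_ _. 0, g)"
  define T where "T = insert (base_unit, \<one>) (?i ` S)"
  have T: "finite T" "T \<subseteq> carrier wreath"
    using S base_unit_in_wreath top_in_wreath by (auto simp: T_def)
  obtain H :: "nat monoid" and emb where H: "group H" "finitely_generated H"
    "emb \<in> hom H wreath" "inj_on emb (carrier H)" "emb ` carrier H = generate wreath T"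
    using W.finitely_generated_nat_model[OF T] by blast
  have "?i ` carrier \<Gamma> = generate wreath (?i ` S)"
    using i.generate_img[OF S(2)] S(3) by simp
  also have "\<dots> \<subseteq> generate wreath T" by (rule W.mono_generate) (auto simp: T_def)
  finally have "?i ` carrier \<Gamma> \<subseteq> emb ` carrier H" using H by simp
  moreover have "(base_unit, \<one>) \<in> emb ` carrier H" using H by (auto simp: T_def intro: generate.incl)
  ultimately have "embedded_group \<Gamma> N U q H emb"
    using H by (intro embedded_group.intro coset_tower_axioms embedded_group_axioms.intro) blast+
  then show thesis using that H(2) by blast
qed

section \<open>Torsion in the homology of the chain\<close>

context embedded_group begin

definition t :: 'h where "t = (SOME z. z \<in> carrier H \<and> emb z = (base_unit, \<one>))"

lemma t: "t \<in> carrier H" "proj t = \<one>" "base t = base_unit"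
proof -
  from base_unit_in_emb obtain z where z: "(base_unit, \<one>) = emb z" "z \<in> carrier H" by (rule imageE)
  have t: "t \<in> carrier H \<and> emb t = (base_unit, \<one>)"
    unfolding t_def by (rule someI[of _ z]) (simp add: z)
  then show "t \<in> carrier H" by simp
  show "proj t = \<one>" "base t = base_unit" by (simp_all add: proj_def base_def t)
qed

definition t_comm :: "'h \<Rightarrow> 'h" where
  "t_comm z = z \<otimes>\<^bsub>H\<^esub> t \<otimes>\<^bsub>H\<^esub> inv\<^bsub>H\<^esub> z \<otimes>\<^bsub>H\<^esub> inv\<^bsub>H\<^esub> t"

lemma t_comm_in_A: "z \<in> carrier H \<Longrightarrow> t_comm z \<in> A"
  using t by (simp add: t_comm_def in_A_iff)

text \<open>Conjugation by \<open>z\<close> translates the delta functions by \<open>proj z\<close>.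
  Multiplying the conjugate by \<open>z\<close> again lets the components of \<open>z\<close>
  cancel.\<close>

lemma base_conj_t:
  assumes z: "z \<in> carrier H" and x: "x \<in> carrier \<Gamma>"
  shows "base (z \<otimes>\<^bsub>H\<^esub> t \<otimes>\<^bsub>H\<^esub> inv\<^bsub>H\<^esub> z) j x = base_unit j (inv (proj z) \<otimes> x)"
proof -
  define y where "y = z \<otimes>\<^bsub>H\<^esub> t \<otimes>\<^bsub>H\<^esub> inv\<^bsub>H\<^esub> z"
  have y: "y \<in> A" "y \<in> carrier H" using z t by (auto simp: y_def in_A_iff)
  have "y \<otimes>\<^bsub>H\<^esub> z = z \<otimes>\<^bsub>H\<^esub> t" using z t by (simp add: y_def H.m_assoc)
  then have "(base y j x + base z j x) mod int (q j) = (base_unit j (inv (proj z) \<otimes> x) + base z j x) mod int (q j)"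
    using base_mult_A[OF y(1) z x, of j] base_mult[OF z t(1) x, of j] t(3) by (simp add: add.commute)
  then have "base y j x mod int (q j) = base_unit j (inv (proj z) \<otimes> x) mod int (q j)"
    by (simp add: mod_eq_dvd_iff)
  then show ?thesis
    using base_range[OF y(2), of j x] by (simp add: y_def base_unit_def)
qed

text \<open>A difference of two delta functions, at the cosets of \<open>proj z\<close> and of
  \<open>\<one>\<close>; it vanishes if these cosets coincide.\<close>

lemma base_t_comm:
  assumes z: "z \<in> carrier H" and x: "x \<in> carrier \<Gamma>"
  shows "base (t_comm z) j x = (of_bool (inv (proj z) \<otimes> x \<in> U j) - of_bool (x \<in> U j)) mod int (q j)"
proof -
  define y where "y = z \<otimes>\<^bsub>H\<^esub> t \<otimes>\<^bsub>H\<^esub> inv\<^bsub>H\<^esub> z"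
  have y: "y \<in> carrier H" using z t by (simp add: y_def)
  have c: "t_comm z \<in> A" "t_comm z \<in> carrier H" using t_comm_in_A[OF z] by (auto simp: in_A_iff)
  have "t_comm z \<otimes>\<^bsub>H\<^esub> t = y" using z t by (simp add: t_comm_def y_def H.m_assoc)
  then have "(base (t_comm z) j x + base_unit j x) mod int (q j) = base y j x mod int (q j)"
    using base_mult_A[OF c(1) t(1) x, of j] t(3) base_range[OF y, of j x] by simp
  then have "(base (t_comm z) j x + base_unit j x - base_unit j x) mod int (q j)
      = (base y j x - base_unit j x) mod int (q j)"
    by (rule mod_diff_cong) simp
  then have "base (t_comm z) j x = (base y j x - base_unit j x) mod int (q j)"
    using base_range[OF c(2), of j x] by simp
  then show ?thesis
    using base_conj_t[OF z x, of j] by (simp add: y_def base_unit_def mod_simps)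
qed

text \<open>For \<open>g\<close> in \<open>U k\<close> for all \<open>k > i\<close>, but not in \<open>U i\<close>, the commutator of \<open>g\<close> with \<open>t\<close> vanishes
  in the components beyond \<open>i\<close>; its \<open>Q\<close>-th power moreover vanishes in the components before \<open>i\<close>.\<close>

lemma T1_M_ge:
  assumes fg: "finitely_generated H"
    and g: "g \<in> carrier \<Gamma>" "g \<notin> U i" "\<And>k. i < k \<Longrightarrow> g \<in> U k"
    and Q: "\<And>j. j < i \<Longrightarrow> q j dvd Q" "q i = Q * m" and m: "m > 1"
    and fin: "finite_index H (M i)"
  shows "m \<le> T1 (H\<lparr>carrier := M i\<rparr>)" "M (Suc i) \<noteq> M i"
proof -
  obtain z where z: "z \<in> carrier H" "proj z = g" using obtain_lift[OF g(1)] by metis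
  define c where "c = t_comm z"
  \<comment> \<open>Since \<open>q j\<close> divides \<open>Q\<close> for \<open>j < i\<close> and
    \<open>q i = Q * m\<close>, the power kills the components before \<open>i\<close> and leaves
    order \<open>m\<close> in component \<open>i\<close>.\<close>
  define e where "e = c [^]\<^bsub>H\<^esub> Q"
  have cA: "c \<in> A" unfolding c_def using z by (intro t_comm_in_A)
  then have eA: "e \<in> A" by (simp add: e_def in_A_iff proj.hom_nat_pow)
  have Qpos: "Q > 0" using Q(2) q_pos[of i] by (cases Q) auto
  have U: "inv g \<in> U j \<longleftrightarrow> g \<in> U j" for j
    using subgroup.m_inv_closed[OF U_subgroup, of _ j] g(1) inv_inv[OF g(1)] by metis
  have Umult: "inv g \<otimes> x \<in> U j \<longleftrightarrow> x \<in> U j" if "g \<in> U j" "x \<in> carrier \<Gamma>" for j x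
  proof -
    interpret U: subgroup "U j" \<Gamma> by (rule U_subgroup)
    have "x = g \<otimes> (inv g \<otimes> x)" using that g by (simp add: m_assoc[symmetric])
    then show ?thesis using that by (metis U.m_closed U.m_inv_closed)
  qed
  have base_e: "base e j x = 0" if "j \<noteq> i" "x \<in> carrier \<Gamma>" for j x
  proof (cases "j < i")
    case True
    then have "int (q j) dvd int Q * base c j x" using Q(1) by simp
    then show ?thesis using base_pow[OF cA that(2)] by (simp add: e_def)
  next
    case False
    then have "g \<in> U j" using that g(3) by simp
    then have "base c j x = 0" using base_t_comm[OF z(1) that(2)] Umult that z(2) by (simp add: c_def)
    then show ?thesis using base_pow[OF cA that(2)] by (simp add: e_def)
  qed
  have "base c i \<one> = (- 1) mod int (q i)"
    using base_t_comm[OF z(1) one_closed, of i] z(2) g U subgroup.one_closed[OF U_subgroup, of i]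
    by (simp add: c_def)
  then have base_e_i: "base e i \<one> = (- int Q) mod int (q i)"
    using base_pow[OF cA one_closed, of Q i] by (simp add: e_def mod_mult_right_eq)
  have eM: "e \<in> M i" using eA base_e subgroup.one_closed[OF N_subgroup] by (auto simp: M_def in_A_iff)
  \<comment> \<open>As \<open>m > 1\<close>, component \<open>i\<close> of \<open>e\<close> is
    nonzero, which makes the chain strictly descending.\<close>
  have "\<not> int (q i) dvd - int Q"
    using Q(2) Qpos m by (simp flip: of_nat_mult)
  then have "base e i \<one> \<noteq> 0" using base_e_i by (simp add: dvd_eq_mod_eq_0)
  then have "e \<notin> M (Suc i)" by (auto simp: M_def)
  then show "M (Suc i) \<noteq> M i" using eM by blast
  \<comment> \<open>The order of \<open>- Q\<close> modulo \<open>Q * m\<close> is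
    \<open>m\<close>.\<close>
  have order: "int m dvd k" if "int (q i) dvd k * base e i \<one>" for k
  proof -
    have "(k * base e i \<one>) mod int (q i) = 0" using that by simp
    then have "(k * - int Q) mod int (q i) = 0" by (simp only: base_e_i mod_mult_right_eq)
    then have "int Q * int m dvd int Q * k" using Q(2) by (simp add: mod_eq_0_iff_dvd mult.commute)
    then show ?thesis using Qpos by simp
  qed
  have "e [^]\<^bsub>H\<^esub> q i = \<one>\<^bsub>H\<^esub>"
  proof (rule emb_eqI)
    fix j x assume x: "x \<in> carrier \<Gamma>"
    show "base (e [^]\<^bsub>H\<^esub> q i) j x = base \<one>\<^bsub>H\<^esub> j x"
      using base_pow[OF eA x, of "q i" j] base_e[OF _ x, of j] by (cases "j = i") (auto simp: base_one)
  qed (use eA in \<open>auto simp: in_A_iff proj.hom_nat_pow\<close>)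
  \<comment> \<open>Evaluation of component \<open>i\<close> at \<open>\<one>\<close> is the
    homomorphism to the integers modulo \<open>q i\<close> that detects \<open>e\<close>; it is
    additive because \<open>M i\<close> lies over \<open>N i\<close>.\<close>
  moreover have "base (y \<otimes>\<^bsub>H\<^esub> w) i \<one> mod int (q i) = (base y i \<one> + base w i \<one>) mod int (q i)"
    if "y \<in> M i" "w \<in> M i" for y w
    using that base_mult_M[of y w i \<one> i] by (simp add: M_def)
  ultimately show "m \<le> T1 (H\<lparr>carrier := M i\<rparr>)"
    using H.T1_subgroup_lower_bound[OF fg M_subgroup fin eM q_pos, where \<phi> = "\<lambda>y. base y i \<one>" and q = "int (q i)"]
      order by blast
qed

text \<open>If \<open>d\<close> is in the derived subgroup of \<open>\<Gamma>\<close>, but not in \<open>U j\<close>, then a lift of \<open>d\<close> to the derived subgroup of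
  \<open>H\<close> does not commute with its commutator with \<open>t\<close>.\<close>

lemma derived_derived_nontrivial:
  assumes d: "d \<in> derived \<Gamma> (carrier \<Gamma>)" "d \<notin> U j" and q: "q j \<ge> 3"
  shows "derived H (derived H (carrier H)) \<noteq> {\<one>\<^bsub>H\<^esub>}"
proof
  assume triv: "derived H (derived H (carrier H)) = {\<one>\<^bsub>H\<^esub>}"
  have comm: "a \<otimes>\<^bsub>H\<^esub> b = b \<otimes>\<^bsub>H\<^esub> a"
    if ab: "a \<in> derived H (carrier H)" "b \<in> derived H (carrier H)" for a b
  proof -
    have abc: "a \<in> carrier H" "b \<in> carrier H" using ab H.derived_in_carrier by auto
    have "a \<otimes>\<^bsub>H\<^esub> b \<otimes>\<^bsub>H\<^esub> inv\<^bsub>H\<^esub> a \<otimes>\<^bsub>H\<^esub> inv\<^bsub>H\<^esub> b \<in> derived H (derived H (carrier H))"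
      unfolding derived_def[of H "derived H (carrier H)"] using ab by (intro generate.incl) blast
    then have "a \<otimes>\<^bsub>H\<^esub> b \<otimes>\<^bsub>H\<^esub> inv\<^bsub>H\<^esub> (b \<otimes>\<^bsub>H\<^esub> a) = \<one>\<^bsub>H\<^esub>"
      using triv abc by (simp add: H.inv_mult_group H.m_assoc)
    then show ?thesis using abc by (metis H.inv_equality H.inv_inv H.m_closed H.inv_closed)
  qed
  have "proj ` carrier H = carrier \<Gamma>" using obtain_lift proj.hom_closed by (metis image_subsetI rev_image_eqI subsetI subset_antisym)
  then obtain z where z: "z \<in> derived H (carrier H)" "proj z = d"
    using d(1) proj.derived_img[of "carrier H"] by auto
  have zc: "z \<in> carrier H" using z H.derived_in_carrier by blast
  have dc: "d \<in> carrier \<Gamma>" using z zc by auto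
  define c where "c = t_comm z"
  have c: "c \<in> A" "c \<in> carrier H" using t_comm_in_A[OF zc] by (auto simp: c_def in_A_iff)
  have "c \<in> derived H (carrier H)"
    unfolding derived_def c_def t_comm_def using zc t by (intro generate.incl) blast
  \<comment> \<open>At \<open>\<one>\<close>, commuting forces the values of \<open>c\<close> at
    \<open>inv d\<close> and at \<open>\<one>\<close> to agree.\<close>
  then have "base (z \<otimes>\<^bsub>H\<^esub> c) j \<one> = base (c \<otimes>\<^bsub>H\<^esub> z) j \<one>" using comm[OF z(1)] by simp
  then have "(base z j \<one> + base c j (inv d)) mod int (q j) = (base z j \<one> + base c j \<one>) mod int (q j)"
    using base_mult[OF zc c(2) one_closed] base_mult_A[OF c(1) zc one_closed] z(2) dc by (simp add: add.commute)
  then have eq: "base c j (inv d) mod int (q j) = base c j \<one> mod int (q j)"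
    by (simp add: mod_eq_dvd_iff)
  have inv: "inv d \<notin> U j" using d(2) dc subgroup.m_inv_closed[OF U_subgroup, of "inv d" j] by auto
  have "base c j \<one> = (- 1) mod int (q j)"
    using base_t_comm[OF zc one_closed, of j] z(2) inv dc subgroup.one_closed[OF U_subgroup, of j]
    by (simp add: c_def)
  moreover have "base c j (inv d) = of_bool (inv d \<otimes> inv d \<in> U j) mod int (q j)"
    using base_t_comm[OF zc inv_closed[OF dc], of j] z(2) inv by (simp add: c_def)
  ultimately have "of_bool (inv d \<otimes> inv d \<in> U j) mod int (q j) = (- 1) mod int (q j)"
    using eq by simp
  \<comment> \<open>The values are 0 or 1 on one side and -1 on the other; they can agree only if
    \<open>q j\<close> divides 1 or 2.\<close>
  then have "int (q j) dvd of_bool (inv d \<otimes> inv d \<in> U j) + 1" by (simp add: mod_eq_dvd_iff)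
  then show False using q by (auto dest!: zdvd_imp_le split: if_splits simp: of_bool_def)
qed

text \<open>The surjection \<open>proj\<close> maps the derived series of \<open>H\<close> onto that
  of \<open>\<Gamma>\<close>, so the \<open>n\<close>-th term of the former lies in the abelian
  kernel \<open>A\<close>.\<close>

lemma exp_derived_Suc_trivial:
  assumes "(derived \<Gamma> ^^ n) (carrier \<Gamma>) = {\<one>}"
  shows "(derived H ^^ Suc n) (carrier H) = {\<one>\<^bsub>H\<^esub>}"
proof -
  define K where "K = (derived H ^^ n) (carrier H)"
  have KH: "K \<subseteq> carrier H" unfolding K_def by (rule H.exp_of_derived_in_carrier) simp
  have "proj ` carrier H = carrier \<Gamma>" using obtain_lift proj.hom_closed by (metis image_subsetI rev_image_eqI subsetI subset_antisym)
  then have "proj ` K = {\<one>}" using assms proj.exp_of_derived_img[of "carrier H" n] by (simp add: K_def)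
  then have "proj z = \<one>" if "z \<in> K" for z using that by blast
  then have "K \<subseteq> A" using KH by (auto simp: in_A_iff)
  have "derived_set H K \<subseteq> {\<one>\<^bsub>H\<^esub>}"
  proof clarify
    fix a b assume ab: "a \<in> K" "b \<in> K"
    then have "a \<in> carrier H" "b \<in> carrier H" "a \<otimes>\<^bsub>H\<^esub> b = b \<otimes>\<^bsub>H\<^esub> a" using KH \<open>K \<subseteq> A\<close> A_commute[of a b] by blast+
    then show "a \<otimes>\<^bsub>H\<^esub> b \<otimes>\<^bsub>H\<^esub> inv\<^bsub>H\<^esub> a \<otimes>\<^bsub>H\<^esub> inv\<^bsub>H\<^esub> b = \<one>\<^bsub>H\<^esub>" by (simp add: H.m_assoc)
  qed
  then have "derived H K \<subseteq> {\<one>\<^bsub>H\<^esub>}"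
    unfolding derived_def by (rule H.generate_subgroup_incl[OF _ H.triv_subgroup])
  then show ?thesis by (auto simp: K_def derived_def intro: generate.one)
qed

end

section \<open>Residual finiteness and the choice of the moduli\<close>

lemma (in group) residually_finite_if_chain:
  assumes "torsion_growth_chain f G M"
  shows "residually_finite G"
  unfolding residually_finite_def
proof
  have M: "\<forall>i. M i \<lhd> G \<and> finite_index G (M i)" "(\<Inter>i. M i) = {\<one>}"
    using assms by (simp_all add: torsion_growth_chain_def)
  fix g assume "g \<in> carrier G - {\<one>}"
  then have "g \<notin> (\<Inter>i. M i)" using M(2) by simp
  then show "\<exists>N. N \<lhd> G \<and> finite_index G N \<and> g \<notin> N" using M(1) by blast
qed

text \<open>The maximum is taken because only an upper bound on the index is known and
  \<open>f\<close> need not be monotone. Adding 3 gives strictness, nontrivial torsion, and moduli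
  of at least 3.\<close>

definition exceeding :: "(nat \<Rightarrow> nat) \<Rightarrow> nat \<Rightarrow> nat" where
  "exceeding f n = 3 + Max (f ` {..n})"

text \<open>With \<open>c i\<close> the index of \<open>N i\<close>, the argument of
  \<open>exceeding\<close> is the bound of \<open>M_index\<close> on the index of
  \<open>M i\<close>. The modulus \<open>q i\<close> is the value at \<open>Suc i\<close>, so that
  the value at \<open>i\<close> is a common multiple of all \<open>q j\<close> with
  \<open>j < i\<close>.\<close>

primrec torsion_modulus :: "(nat \<Rightarrow> nat) \<Rightarrow> (nat \<Rightarrow> nat) \<Rightarrow> nat \<Rightarrow> nat" where
  "torsion_modulus f c 0 = 1"
| "torsion_modulus f c (Suc i) = torsion_modulus f c i *
    exceeding f (c i * torsion_modulus f c i ^ (i * c i))"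

lemma torsion_modulus_dvd: "i \<le> j \<Longrightarrow> torsion_modulus f c i dvd torsion_modulus f c j"
  by (induction j rule: dec_induct) auto

lemma torsion_modulus_pos: "torsion_modulus f c i > 0"
  by (induction i) (auto simp: exceeding_def)

lemma torsion_modulus_Suc_ge_3: "torsion_modulus f c (Suc i) \<ge> 3"
proof -
  have "1 * 3 \<le> torsion_modulus f c i * exceeding f (c i * torsion_modulus f c i ^ (i * c i))"
    using torsion_modulus_pos[of f c i] by (intro mult_mono) (auto simp: exceeding_def)
  then show ?thesis by simp
qed

text \<open>The chain starts at \<open>M (Suc 0)\<close>, which lies strictly below
  \<open>M 0\<close> and is therefore proper; \<open>M 0\<close> itself might be the whole
  group.\<close>

lemma (in embedded_group) torsion_growth_chain_M:
  assumes fg: "finitely_generated H"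
    and g: "\<And>i. g i \<in> carrier \<Gamma>" "\<And>i. g i \<notin> U i" "\<And>i k. i < k \<Longrightarrow> g i \<in> U k"
    and q: "q = (\<lambda>i. torsion_modulus f (\<lambda>i. card (rcosets N i)) (Suc i))"
  shows "torsion_growth_chain f H (\<lambda>i. M (Suc i))"
proof -
  define c where "c i = card (rcosets N i)" for i
  define Q where "Q = torsion_modulus f c"
  define m where "m i = exceeding f (c i * Q i ^ (i * c i))" for i
  have q': "q i = Q i * m i" "q i = Q (Suc i)" for i by (simp_all add: q Q_def m_def c_def[abs_def])
  have dvd: "q j dvd Q i" if "j < i" for i j
    using that unfolding q'(2) Q_def by (intro torsion_modulus_dvd) simp
  have le: "q j \<le> Q i" if "j < i" for i j
    using dvd[OF that] torsion_modulus_pos by (auto simp: Q_def intro: dvd_imp_le)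
  have idx: "finite_index H (M i)" "subgroup_index H (M i) \<le> c i * Q i ^ (i * c i)" for i
    using M_index[of i "Q i"] le by (auto simp: c_def)
  have T: "m i \<le> T1 (H\<lparr>carrier := M i\<rparr>)" "M (Suc i) \<noteq> M i" for i
    using T1_M_ge[OF fg g(1,2,3) dvd q'(1) _ idx(1)] by (auto simp: m_def exceeding_def)
  have "f (subgroup_index H (M i)) < m i" for i
  proof -
    have "f (subgroup_index H (M i)) \<le> Max (f ` {..c i * Q i ^ (i * c i)})"
      using idx(2) by (intro Max_ge) auto
    then show ?thesis by (simp add: m_def exceeding_def)
  qed
  then have "f (subgroup_index H (M i)) < T1 (H\<lparr>carrier := M i\<rparr>)" for i
    using T(1)[of i] less_le_trans by blast
  moreover have "M (Suc i) \<subset> M i" for i using M_Suc T(2) by blast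
  moreover have "M (Suc 0) \<subset> carrier H" using \<open>M (Suc 0) \<subset> M 0\<close> by (auto simp: M_def)
  moreover have "(\<Inter>i. M (Suc i)) = (\<Inter>i. M i)" using M_Suc by blast
  ultimately show ?thesis
    using M_normal idx M_Inter by (auto simp: torsion_growth_chain_def)
qed

section \<open>The lamplighter group\<close>

definition dyadic :: "nat \<Rightarrow> int set" where
  "dyadic j = {n. 2 ^ j dvd n}"

lemma dyadic_subgroup: "subgroup (dyadic j) integer_group"
  by (rule group.subgroupI) (auto simp: dyadic_def)

lemma dyadic_Inter: "(\<Inter>j. dyadic j) = {0}"
proof -
  have "n = 0" if "\<forall>j. 2 ^ j dvd n" for n :: int
  proof (rule ccontr)
    assume "n \<noteq> 0"
    then have "2 ^ nat \<bar>n\<bar> \<le> \<bar>n\<bar>" using that zdvd_imp_le[of "2 ^ nat \<bar>n\<bar>" "\<bar>n\<bar>"] by simp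
    moreover have "int (nat \<bar>n\<bar>) < int (2 ^ nat \<bar>n\<bar>)" by (simp only: of_nat_less_iff less_exp)
    ultimately show False by simp
  qed
  then show ?thesis by (auto simp: dyadic_def)
qed

text \<open>With \<open>N\<close> and \<open>U\<close> equal, component \<open>j\<close> consists of
  the functions from the integers modulo \<open>2 ^ j\<close> to the integers modulo 2.\<close>

lemma coset_tower_dyadic: "coset_tower integer_group dyadic dyadic (\<lambda>_. 2)"
proof -
  interpret Z: comm_group integer_group by (rule abelian_integer_group)
  have "finite (rcosets\<^bsub>integer_group\<^esub> (dyadic i))" for i
    using Z.subgroup_index_le(1)[OF dyadic_subgroup, of "{0..<2 ^ i}" "\<lambda>x. x mod 2 ^ i" i]
    by (auto simp: finite_index_def dyadic_def mod_eq_dvd_iff)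
  moreover have "dyadic (Suc i) \<subseteq> dyadic i" for i
    by (auto simp: dyadic_def elim: dvd_mult_right)
  ultimately show ?thesis
    using dyadic_subgroup dyadic_Inter Z.subgroup_imp_normal
    by (intro coset_tower.intro coset_tower_axioms.intro) auto
qed

lemma finitely_generated_integer_group: "finitely_generated integer_group"
proof -
  obtain x where "subgroup_generated integer_group {x} = integer_group"
    using cyclic_integer_group by (auto simp: cyclic_group_def)
  then have "carrier (subgroup_generated integer_group {x}) = carrier integer_group" by simp
  then have "generate integer_group {x} = carrier integer_group"
    by (simp add: carrier_subgroup_generated)
  then show ?thesis unfolding finitely_generated_def by (intro exI[of _ "{x}"]) simp
qed

text \<open>Here \<open>H\<close> is the lamplighter group: \<open>t\<close> switches on the lamp at \<open>0\<close>, and \<open>base z j\<close> counts modulo 2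
  the lit lamps in the residue classes modulo \<open>2 ^ j\<close>.\<close>

locale lamplighter = embedded_group integer_group dyadic dyadic "\<lambda>_. 2" H emb
  for H :: "('h, 'k) monoid_scheme" and emb
begin

text \<open>The subgroups \<open>U j\<close> of the second tower: component \<open>j\<close> may be
  nonzero only at the residues \<open>0, ..., j - 1\<close>, so that the lamp at \<open>i\<close> is
  allowed exactly from \<open>j = i + 1\<close> on.\<close>

definition initial_lamps :: "nat \<Rightarrow> 'h set" where
  "initial_lamps j = {z \<in> carrier H. proj z \<in> dyadic j \<and> (\<forall>x. \<not> x mod 2 ^ j < int j \<longrightarrow> base z j x = 0)}"

definition lamp :: "nat \<Rightarrow> 'h" where
  "lamp i = (let s = (SOME s. s \<in> carrier H \<and> proj s = int i) in s \<otimes>\<^bsub>H\<^esub> t \<otimes>\<^bsub>H\<^esub> inv\<^bsub>H\<^esub> s)"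

lemma lamp: "lamp i \<in> carrier H" "proj (lamp i) = 0" "base (lamp i) j x = of_bool (x - int i \<in> dyadic j)"
proof -
  define s where "s = (SOME s. s \<in> carrier H \<and> proj s = int i)"
  obtain z where "z \<in> carrier H" "proj z = int i"
    using obtain_lift[of "int i"] by (metis UNIV_I carrier_integer_group)
  then have s: "s \<in> carrier H" "proj s = int i"
    unfolding s_def using someI_ex[of "\<lambda>s. s \<in> carrier H \<and> proj s = int i"] by auto
  have l: "lamp i = s \<otimes>\<^bsub>H\<^esub> t \<otimes>\<^bsub>H\<^esub> inv\<^bsub>H\<^esub> s" by (simp add: lamp_def s_def Let_def)
  show "lamp i \<in> carrier H" "proj (lamp i) = 0" using s t by (simp_all add: l)
  show "base (lamp i) j x = of_bool (x - int i \<in> dyadic j)"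
    using base_conj_t[OF s(1), of x j] s by (simp add: l base_unit_def)
qed

lemma base_mult_dyadic:
  assumes "y \<in> carrier H" "w \<in> carrier H" "proj y \<in> dyadic j"
  shows "base (y \<otimes>\<^bsub>H\<^esub> w) j x = (base y j x + base w j x) mod 2"
  using base_mult_N[OF assms, of x] by simp

lemma initial_lamps_subgroup: "subgroup (initial_lamps j) H"
proof (rule H.subgroupI)
  show "initial_lamps j \<subseteq> carrier H" by (auto simp: initial_lamps_def)
  have "\<one>\<^bsub>H\<^esub> \<in> initial_lamps j" by (simp add: initial_lamps_def base_one dyadic_def)
  then show "initial_lamps j \<noteq> {}" by auto
  fix y assume y: "y \<in> initial_lamps j"
  then have yc: "y \<in> carrier H" "proj y \<in> dyadic j" by (auto simp: initial_lamps_def)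
  have inv: "proj (inv\<^bsub>H\<^esub> y) \<in> dyadic j" using yc by (simp add: dyadic_def)
  have "base (inv\<^bsub>H\<^esub> y) j x = 0" if "\<not> x mod 2 ^ j < int j" for x
    using base_mult_dyadic[OF _ yc(1) inv, of x] yc(1) y that base_range[of "inv\<^bsub>H\<^esub> y" j x]
    by (simp add: base_one initial_lamps_def)
  then show "inv\<^bsub>H\<^esub> y \<in> initial_lamps j" using yc inv by (simp add: initial_lamps_def)
  fix w assume w: "w \<in> initial_lamps j"
  then have wc: "w \<in> carrier H" "proj w \<in> dyadic j" by (auto simp: initial_lamps_def)
  show "y \<otimes>\<^bsub>H\<^esub> w \<in> initial_lamps j"
    using y w yc wc base_mult_dyadic[OF yc(1) wc(1) yc(2)] by (simp add: initial_lamps_def dyadic_def)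
qed

text \<open>The shift to \<open>M (Suc j)\<close> gives the inclusion in
  \<open>initial_lamps j\<close>: its elements vanish also in component \<open>j\<close>.\<close>

lemma coset_tower_initial_lamps:
  assumes "\<And>i. q i > 0"
  shows "coset_tower H (\<lambda>j. M (Suc j)) initial_lamps q"
proof (intro coset_tower.intro coset_tower_axioms.intro)
  show "group H" by (rule H.is_group)
  show "M (Suc i) \<lhd> H" for i by (rule M_normal)
  show "finite (rcosets\<^bsub>H\<^esub> M (Suc i))" for i
    using M_index(1)[of "Suc i" 2] by (simp add: finite_index_def)
  show "M (Suc (Suc i)) \<subseteq> M (Suc i)" for i by (rule M_Suc)
  show "(\<Inter>i. M (Suc i)) = {\<one>\<^bsub>H\<^esub>}" using M_Inter M_Suc by blast
  show "subgroup (initial_lamps i) H" for i by (rule initial_lamps_subgroup)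
  show "M (Suc i) \<subseteq> initial_lamps i" for i
    using N_Suc[of i] by (auto simp: M_def initial_lamps_def)
qed (rule assms)

lemma int_less_exp: "int k < 2 ^ k"
proof -
  have "int k < int (2 ^ k)" by (simp only: of_nat_less_iff less_exp)
  then show ?thesis by simp
qed

text \<open>Since \<open>i < 2 ^ i\<close>, the residue of \<open>i\<close> is \<open>i\<close>
  itself, the first value that \<open>initial_lamps i\<close> excludes.\<close>

lemma lamp_notin_initial_lamps: "lamp i \<notin> initial_lamps i"
proof -
  have "base (lamp i) i (int i) \<noteq> 0" by (simp add: lamp dyadic_def)
  moreover have "\<not> int i mod 2 ^ i < int i"
    using int_less_exp[of i] by simp
  ultimately show ?thesis unfolding initial_lamps_def by blast
qed

lemma lamp_in_initial_lamps:
  assumes "i < k" shows "lamp i \<in> initial_lamps k"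
proof -
  have "int i mod 2 ^ k = int i"
    using assms int_less_exp[of k] by (intro mod_pos_pos_trivial) linarith+
  then have "int i mod 2 ^ k < int k" using assms by simp
  then have "x mod 2 ^ k < int k" if "2 ^ k dvd x - int i" for x
    using that by (simp flip: mod_eq_dvd_iff)
  then show ?thesis by (auto simp: initial_lamps_def lamp dyadic_def)
qed

text \<open>The commutator of a shift by 1 with \<open>t\<close> has a lamp at the odd residue,
  whereas \<open>initial_lamps 1\<close> allows only residue 0. It serves to show that
  \<open>G\<close> is not metabelian.\<close>

lemma derived_not_initial: "\<exists>d\<in>derived H (carrier H). d \<notin> initial_lamps 1"
proof -
  obtain s where s: "s \<in> carrier H" "proj s = 1" using obtain_lift[of 1] by (metis UNIV_I carrier_integer_group)
  have "base (t_comm s) 1 1 = 1" using base_t_comm[OF s(1), of 1 1] s by (simp add: dyadic_def)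
  then have "t_comm s \<notin> initial_lamps 1" by (auto simp: initial_lamps_def intro!: exI[of _ 1])
  moreover have "t_comm s \<in> derived H (carrier H)"
    unfolding derived_def t_comm_def using s t by (intro generate.incl) blast
  ultimately show ?thesis by blast
qed

lemma metabelian: "(derived H ^^ 2) (carrier H) = {\<one>\<^bsub>H\<^esub>}"
proof -
  interpret Z: comm_group integer_group by (rule abelian_integer_group)
  have "derived integer_group (carrier integer_group) = {\<one>\<^bsub>integer_group\<^esub>}"
    by (intro Z.derived_eq_singleton) simp
  then show ?thesis using exp_derived_Suc_trivial[of 1] by (simp add: numeral_2_eq_2)
qed

end

text \<open>Once trivial, the derived series stays trivial, so no earlier term than the third can
  be.\<close>

lemma (in group) derived_length_eq_3:
  assumes "(derived G ^^ 3) (carrier G) = {\<one>}" "(derived G ^^ 2) (carrier G) \<noteq> {\<one>}"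
  shows "derived_length G = 3"
  unfolding derived_length_def
proof (rule Least_equality)
  show "(derived G ^^ 3) (carrier G) = {\<one>}" by fact
  fix n assume n: "(derived G ^^ n) (carrier G) = {\<one>}"
  have triv: "derived G {\<one>} = {\<one>}"
    by (auto simp: derived_def intro: generate.one dest: generate_in_carrier)
      (use generate_subgroup_incl[OF _ triv_subgroup, of "{\<one>}"] in auto)
  have "(derived G ^^ m) (carrier G) = {\<one>}" if "n \<le> m" for m
    using that by (induction m rule: dec_induct) (simp_all add: n triv)
  then show "3 \<le> n" using assms(2) by (metis Suc_1 eval_nat_numeral(3) not_less_eq_eq)
qed

lemma solvable_torsion_growth:
  "\<exists>(G :: nat monoid) M. group G \<and> finitely_generated G \<and> residually_finite G \<and>
     torsion_growth_chain f G M \<and> solvable G \<and> derived_length G = 3"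
proof -
  interpret Z: coset_tower integer_group dyadic dyadic "\<lambda>_. 2" by (rule coset_tower_dyadic)
  obtain L :: "nat monoid" and e where L: "embedded_group integer_group dyadic dyadic (\<lambda>_. 2) L e" "finitely_generated L"
    using Z.embedded_group_exists[OF finitely_generated_integer_group] .
  interpret L: lamplighter L e using L(1) by (simp add: lamplighter_def)
  \<comment> \<open>The second tower runs over \<open>L\<close>, with the first chain
    \<open>L.M (Suc i)\<close> as its normal subgroups, so their indices enter.\<close>
  define q where "q = (\<lambda>i. torsion_modulus f (\<lambda>i. card (rcosets\<^bsub>L\<^esub> (L.M (Suc i)))) (Suc i))"
  have "q i > 0" for i unfolding q_def by (rule torsion_modulus_pos)
  then interpret T: coset_tower L "\<lambda>j. L.M (Suc j)" L.initial_lamps q by (rule L.coset_tower_initial_lamps)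
  obtain G :: "nat monoid" and e' where G: "embedded_group L (\<lambda>j. L.M (Suc j)) L.initial_lamps q G e'" "finitely_generated G"
    using T.embedded_group_exists[OF L(2)] .
  interpret G: embedded_group L "\<lambda>j. L.M (Suc j)" L.initial_lamps q G e' by (rule G(1))
  have chain: "torsion_growth_chain f G (\<lambda>i. G.M (Suc i))"
    using L.lamp(1) L.lamp_notin_initial_lamps L.lamp_in_initial_lamps
    by (intro G.torsion_growth_chain_M[OF G(2), where g = L.lamp]) (auto simp: q_def)
  have d3: "(derived G ^^ 3) (carrier G) = {\<one>\<^bsub>G\<^esub>}"
    using G.exp_derived_Suc_trivial[OF L.metabelian] by (simp add: eval_nat_numeral)
  obtain d where d: "d \<in> derived L (carrier L)" "d \<notin> L.initial_lamps 1" using L.derived_not_initial by blast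
  have "q 1 \<ge> 3" unfolding q_def by (rule torsion_modulus_Suc_ge_3)
  then have "(derived G ^^ 2) (carrier G) \<noteq> {\<one>\<^bsub>G\<^esub>}"
    using G.derived_derived_nontrivial[OF d] by (simp add: numeral_2_eq_2)
  then have "derived_length G = 3" using d3 by (intro G.H.derived_length_eq_3)
  moreover have "solvable G" using d3 G.H.solvable_iff_trivial_derived_seq by blast
  ultimately show ?thesis
    using chain G(2) G.H.residually_finite_if_chain[OF chain] G.H.is_group by blast
qed

section \<open>Grigorchuk's group\<close>

abbreviation grig :: "(bool list \<Rightarrow> bool list) set" where
  "grig \<equiv> carrier grigorchuk_group"

lemma group_grigorchuk: "group grigorchuk_group"
  unfolding grigorchuk_group_def by (rule group.group_subgroup_generated[OF group_BijGroup])

interpretation grig: group grigorchuk_group by (rule group_grigorchuk)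

lemma grig_eq_generate: "grig = generate (BijGroup UNIV) {grig_a, grig_b, grig_c, grig_d}"
  using grig_generators_in_carrier by (simp add: grigorchuk_group_def carrier_subgroup_generated Int_absorb1)

lemma BijGroup_UNIV_mult: "f \<in> carrier (BijGroup UNIV) \<Longrightarrow> g \<in> carrier (BijGroup UNIV) \<Longrightarrow>
    f \<otimes>\<^bsub>BijGroup UNIV\<^esub> g = f \<circ> g"
  by (auto simp: BijGroup_def compose_def)

lemma BijGroup_UNIV_one: "\<one>\<^bsub>BijGroup UNIV\<^esub> = id"
  by (rule ext) (simp add: BijGroup_def)

lemma grig_subset: "grig \<subseteq> carrier (BijGroup UNIV)"
  unfolding grig_eq_generate
  by (rule group.generate_incl[OF group_BijGroup grig_generators_in_carrier])

lemma grig_mult [simp]: "f \<in> grig \<Longrightarrow> g \<in> grig \<Longrightarrow> f \<otimes>\<^bsub>grigorchuk_group\<^esub> g = f \<circ> g"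
  using BijGroup_UNIV_mult grig_subset by (auto simp: grigorchuk_group_def)

lemma grig_one [simp]: "\<one>\<^bsub>grigorchuk_group\<^esub> = id"
  by (auto simp: grigorchuk_group_def BijGroup_def)

lemma grig_comp: "f \<in> grig \<Longrightarrow> g \<in> grig \<Longrightarrow> f \<circ> g \<in> grig"
  using grig.m_closed by simp

lemma grig_id: "id \<in> grig"
  using grig.one_closed by simp

lemma grig_gens: "grig_a \<in> grig" "grig_b \<in> grig" "grig_c \<in> grig" "grig_d \<in> grig"
  unfolding grig_eq_generate by (auto intro: generate.incl)

lemma grig_inv: "f \<in> grig \<Longrightarrow> f \<circ> inv\<^bsub>grigorchuk_group\<^esub> f = id" "f \<in> grig \<Longrightarrow> inv\<^bsub>grigorchuk_group\<^esub> f \<circ> f = id"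
  using grig.r_inv[of f] grig.l_inv[of f] by simp_all

lemma grig_involutions:
  "grig_a \<circ> grig_a = id" "grig_b \<circ> grig_b = id" "grig_c \<circ> grig_c = id" "grig_d \<circ> grig_d = id"
  by (auto simp: grig_a_involution grig_bcd_involution)

text \<open>The generators are involutions, so the case of inverses disappears.\<close>

lemma grig_induct [consumes 1, case_names id gen comp]:
  assumes "x \<in> grig" "P id" "\<And>g. g \<in> {grig_a, grig_b, grig_c, grig_d} \<Longrightarrow> P g"
    and "\<And>f g. f \<in> grig \<Longrightarrow> g \<in> grig \<Longrightarrow> P f \<Longrightarrow> P g \<Longrightarrow> P (f \<circ> g)"
  shows "P x"
proof -
  interpret B: group "BijGroup (UNIV :: bool list set)" by (rule group_BijGroup)
  let ?S = "{grig_a, grig_b, grig_c, grig_d}"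
  have "x \<in> generate (BijGroup UNIV) ?S" using assms(1) by (simp add: grig_eq_generate)
  then show ?thesis
  proof (induction rule: generate.induct)
    case one
    then show ?case using assms(2) by (simp only: BijGroup_UNIV_one)
  next
    case (incl h) then show ?case by (rule assms(3))
  next
    case (inv h)
    have h: "h \<in> carrier (BijGroup UNIV)" using inv grig_generators_in_carrier by auto
    have "h \<circ> h = id" using inv grig_involutions by auto
    then have "h \<otimes>\<^bsub>BijGroup UNIV\<^esub> h = \<one>\<^bsub>BijGroup UNIV\<^esub>"
      by (simp only: BijGroup_UNIV_mult[OF h h] BijGroup_UNIV_one)
    then have "inv\<^bsub>BijGroup UNIV\<^esub> h = h" using h by (intro B.inv_equality)
    then show ?case using assms(3) inv by simp
  next
    case (eng f g)
    then have "f \<in> grig" "g \<in> grig" by (simp_all add: grig_eq_generate)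
    moreover from this have "f \<otimes>\<^bsub>BijGroup UNIV\<^esub> g = f \<circ> g"
      using grig_subset BijGroup_UNIV_mult by blast
    ultimately show ?case using assms(4) eng.IH by (simp only:)
  qed
qed

lemma grig_length: "x \<in> grig \<Longrightarrow> length (x w) = length w"
proof (induction arbitrary: w rule: grig_induct)
  case (gen g)
  have a: "length (grig_a w) = length w" for w by (cases w) auto
  have "length (grig_b w) = length w" "length (grig_c w) = length w" "length (grig_d w) = length w" for w
    by (induction w rule: grig_b_grig_c_grig_d.induct) (auto simp: a)
  then show ?case using gen a by auto
qed auto

lemma finitely_generated_grigorchuk: "finitely_generated grigorchuk_group"
proof -
  let ?S = "{grig_a, grig_b, grig_c, grig_d}"
  have "x \<in> generate grigorchuk_group ?S" if "x \<in> grig" for x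
    using that
  proof (induction rule: grig_induct)
    case id then show ?case using generate.one[of grigorchuk_group ?S] by (simp only: grig_one)
  next
    case (gen g) then show ?case by (rule generate.incl)
  next
    case (comp f g) then show ?case using generate.eng[of f grigorchuk_group ?S g] by (simp only: grig_mult)
  qed
  moreover have "?S \<subseteq> grig" using grig_gens by simp
  ultimately show ?thesis
    unfolding finitely_generated_def using grig.generate_incl[of ?S] by (intro exI[of _ ?S]) auto
qed

section \<open>Wreath recursion and elements supported below one vertex\<close>

fun pair_map :: "(bool list \<Rightarrow> bool list) \<Rightarrow> (bool list \<Rightarrow> bool list) \<Rightarrow> bool list \<Rightarrow> bool list" where
  "pair_map f g [] = []"
| "pair_map f g (False # w) = False # f w"
| "pair_map f g (True # w) = True # g w"

lemma pair_map_id: "pair_map id id w = w"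
  by (cases w; cases "hd w") auto

lemma pair_map_comp: "pair_map f g \<circ> pair_map f' g' = pair_map (f \<circ> f') (g \<circ> g')"
proof
  show "(pair_map f g \<circ> pair_map f' g') w = pair_map (f \<circ> f') (g \<circ> g') w" for w
    by (cases w; cases "hd w") auto
qed

lemma grig_bcd_pair_map:
  "grig_b = pair_map grig_a grig_c" "grig_c = pair_map grig_a grig_d" "grig_d = pair_map id grig_b"
proof -
  have "grig_b w = pair_map grig_a grig_c w \<and> grig_c w = pair_map grig_a grig_d w \<and>
      grig_d w = pair_map id grig_b w" for w
  proof (cases w)
    case (Cons x v) then show ?thesis by (cases x) auto
  qed auto
  then show "grig_b = pair_map grig_a grig_c" "grig_c = pair_map grig_a grig_d" "grig_d = pair_map id grig_b"
    by auto
qed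

lemma grig_a_conj_pair_map: "grig_a \<circ> pair_map f g \<circ> grig_a = pair_map g f"
proof
  show "(grig_a \<circ> pair_map f g \<circ> grig_a) w = pair_map g f w" for w
    by (cases w; cases "hd w") auto
qed

lemma grig_aba: "grig_a \<circ> grig_b \<circ> grig_a = pair_map grig_c grig_a"
  using grig_a_conj_pair_map[of grig_a grig_c] grig_bcd_pair_map(1) by simp

text \<open>Below \<open>True\<close>, the generators \<open>a\<close>, \<open>b\<close>,
  \<open>c\<close>, \<open>d\<close> are the actions of \<open>aba\<close>, \<open>d\<close>,
  \<open>b\<close>, \<open>c\<close>.\<close>

lemma grig_section_exists: "g \<in> grig \<Longrightarrow> \<exists>f. pair_map f g \<in> grig"
proof (induction rule: grig_induct)
  case id
  have "pair_map id id = id" by (rule ext) (auto simp: pair_map_id)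
  then show ?case using grig_id by metis
next
  case (gen g)
  have "pair_map grig_c grig_a \<in> grig" using grig_gens grig_comp by (simp flip: grig_aba)
  moreover have "pair_map grig_a grig_c \<in> grig" "pair_map grig_a grig_d \<in> grig" "pair_map id grig_b \<in> grig"
    using grig_gens grig_bcd_pair_map by simp_all
  ultimately show ?case using gen by auto
next
  case (comp g h) then show ?case by (metis pair_map_comp grig_comp)
qed

abbreviation lift_True :: "(bool list \<Rightarrow> bool list) \<Rightarrow> bool list \<Rightarrow> bool list" where
  "lift_True \<equiv> pair_map id"

text \<open>Here \<open>h\<close> is the inverse of \<open>g\<close>. If \<open>pair_map f g\<close>
  lies in the group, conjugating \<open>lift_True x\<close> by it lifts the conjugate of
  \<open>x\<close> by \<open>g\<close>; the induction continues with these two elements in place of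
  \<open>g\<close> and \<open>x\<close>.\<close>

lemma lift_True_conj:
  assumes "\<And>j. (lift_True ^^ j) x \<in> grig" "g \<in> grig" "h \<in> grig" "h \<circ> g = id"
  shows "(lift_True ^^ j) (g \<circ> x \<circ> h) \<in> grig"
  using assms
proof (induction j arbitrary: x g h)
  case 0
  have "x \<in> grig" using "0.prems"(1)[of 0] by (simp only: funpow_0)
  then have "g \<circ> x \<circ> h \<in> grig" using 0 by (intro grig_comp)
  then show ?case by (simp only: funpow_0)
next
  case (Suc j)
  obtain f where f: "pair_map f g \<in> grig" using grig_section_exists Suc.prems by blast
  define k where "k = inv\<^bsub>grigorchuk_group\<^esub> (pair_map f g)"
  have k: "k \<in> grig" "pair_map f g \<circ> k = id" "k \<circ> pair_map f g = id"
    using f grig_inv by (auto simp: k_def)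
  have "lift_True (g \<circ> x \<circ> h) \<circ> pair_map f g = pair_map f g \<circ> lift_True x"
    by (simp only: pair_map_comp comp_assoc Suc.prems(4) comp_id id_comp)
  then have "lift_True (g \<circ> x \<circ> h) = pair_map f g \<circ> lift_True x \<circ> k"
    using k(2) by (metis comp_assoc comp_id)
  moreover have l: "(lift_True ^^ i) (lift_True x) \<in> grig" for i
    using Suc.prems(1)[of "Suc i"] by (simp only: funpow_Suc_right comp_apply)
  moreover have "(lift_True ^^ j) (pair_map f g \<circ> lift_True x \<circ> k) \<in> grig"
    by (rule Suc.IH[OF l f k(1,3)])
  ultimately have "(lift_True ^^ j) (lift_True (g \<circ> x \<circ> h)) \<in> grig"
    by (simp only:)
  then show ?case by (simp only: funpow_Suc_right comp_apply[of "lift_True ^^ j" lift_True])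
qed

text \<open>Contains the image of the substitution \<open>a \<mapsto> aba\<close>, \<open>b \<mapsto> d\<close>, \<open>c \<mapsto> b\<close>, \<open>d \<mapsto> c\<close>, which maps a word for \<open>g\<close>
  to a word for an element acting as \<open>g\<close> below \<open>True\<close>. On this set the action below \<open>False\<close>
  is by \<open>1\<close> or \<open>a\<close>, and becomes trivial after squaring.\<close>

inductive_set substitution_set :: "(bool list \<Rightarrow> bool list) set" where
  aba: "grig_a \<circ> grig_b \<circ> grig_a \<in> substitution_set"
| b: "grig_b \<in> substitution_set"
| c: "grig_c \<in> substitution_set"
| d: "grig_d \<in> substitution_set"
| comp: "f \<in> substitution_set \<Longrightarrow> g \<in> substitution_set \<Longrightarrow> f \<circ> g \<in> substitution_set"

lemma substitution_set_grig: "x \<in> substitution_set \<Longrightarrow> x \<in> grig"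
  by (induction rule: substitution_set.induct) (assumption | intro grig_comp grig_gens)+

text \<open>For \<open>aba\<close> the preimage is \<open>aba d aba\<close>, with action
  \<open>c \<circ> c = id\<close> below \<open>False\<close>; for the others it is a generator.
  Products keep \<open>f\<close> in the group \<open>{id, grig_a}\<close>.\<close>

lemma substitution_set_section:
  "x \<in> substitution_set \<Longrightarrow> \<exists>f\<in>{id, grig_a}. pair_map f x \<in> substitution_set"
proof (induction rule: substitution_set.induct)
  case aba
  have "(grig_a \<circ> grig_b \<circ> grig_a) \<circ> grig_d \<circ> (grig_a \<circ> grig_b \<circ> grig_a)
      = pair_map (grig_c \<circ> grig_c) (grig_a \<circ> grig_b \<circ> grig_a)"
    unfolding grig_aba by (subst grig_bcd_pair_map(3)) (simp add: pair_map_comp, simp only: grig_aba)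
  also have "\<dots> = pair_map id (grig_a \<circ> grig_b \<circ> grig_a)" using grig_involutions by simp
  finally show ?case
    by (metis insertI1 substitution_set.aba substitution_set.d substitution_set.comp)
next
  case b
  have "pair_map id grig_b \<in> substitution_set"
    using substitution_set.d by (simp only: grig_bcd_pair_map(3)[symmetric])
  then show ?case by blast
next
  case c
  have "pair_map grig_a grig_c \<in> substitution_set"
    using substitution_set.b by (simp only: grig_bcd_pair_map(1)[symmetric])
  then show ?case by blast
next
  case d
  have "pair_map grig_a grig_d \<in> substitution_set"
    using substitution_set.c by (simp only: grig_bcd_pair_map(2)[symmetric])
  then show ?case by blast
next
  case (comp g h)
  then obtain f f' where f: "f \<in> {id, grig_a}" "f' \<in> {id, grig_a}"
    "pair_map f g \<in> substitution_set" "pair_map f' h \<in> substitution_set" by blast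
  then have "pair_map (f \<circ> f') (g \<circ> h) \<in> substitution_set"
    using substitution_set.comp by (metis pair_map_comp)
  moreover have "f \<circ> f' \<in> {id, grig_a}" using f grig_involutions by auto
  ultimately show ?case by blast
qed

abbreviation grig_abab :: "bool list \<Rightarrow> bool list" where
  "grig_abab \<equiv> (grig_a \<circ> grig_b) \<circ> (grig_a \<circ> grig_b)"

text \<open>Carrying a square root \<open>u\<close> along makes the induction work: \<open>u\<close>
  lifts to \<open>pair_map f u\<close> with \<open>f\<close> an involution or trivial, and squaring
  removes \<open>f\<close>. The start is \<open>u = abad\<close>, acting as \<open>c\<close> below
  \<open>False\<close> and as \<open>ab\<close> below \<open>True\<close>.\<close>

lemma lift_True_abab_square: "\<exists>u\<in>substitution_set. (lift_True ^^ Suc j) grig_abab = u \<circ> u"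
proof (induction j)
  case 0
  define u where "u = grig_a \<circ> grig_b \<circ> grig_a \<circ> grig_d"
  have "u = pair_map grig_c (grig_a \<circ> grig_b)"
    unfolding u_def grig_aba by (subst grig_bcd_pair_map(3)) (simp add: pair_map_comp)
  then have "u \<circ> u = pair_map (grig_c \<circ> grig_c) grig_abab" by (simp add: pair_map_comp)
  then have "(lift_True ^^ Suc 0) grig_abab = u \<circ> u"
    by (simp only: grig_involutions funpow.simps comp_apply id_apply)
  moreover have "u \<in> substitution_set" unfolding u_def by (intro substitution_set.intros)
  ultimately show ?case by blast
next
  case (Suc j)
  then obtain u where u: "u \<in> substitution_set" "(lift_True ^^ Suc j) grig_abab = u \<circ> u" by blast
  obtain f where f: "f \<in> {id, grig_a}" "pair_map f u \<in> substitution_set"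
    using substitution_set_section[OF u(1)] by blast
  have "f \<circ> f = id" using f grig_involutions by auto
  then have "(lift_True ^^ Suc (Suc j)) grig_abab = pair_map f u \<circ> pair_map f u"
    using u(2) by (simp add: pair_map_comp)
  then show ?case using f by blast
qed

lemma lift_True_abab: "(lift_True ^^ j) grig_abab \<in> grig"
proof (cases j)
  case 0 then show ?thesis by (simp only: funpow_0) (intro grig_comp grig_gens)
next
  case (Suc i)
  then show ?thesis using lift_True_abab_square[of i] substitution_set_grig grig_comp by metis
qed

text \<open>The element \<open>(ab)^2\<close> transplanted below the vertex \<open>1^j 0\<close>,
  and trivial elsewhere.\<close>

definition grig_rigid :: "nat \<Rightarrow> bool list \<Rightarrow> bool list" where
  "grig_rigid j = (lift_True ^^ j) (pair_map grig_abab id)"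

text \<open>Conjugation by \<open>a\<close> moves the copy of \<open>(ab)^2\<close> from below
  \<open>True\<close> to below \<open>False\<close>, and \<open>lift_True_conj\<close> carries this
  through all lifts.\<close>

lemma grig_rigid_in_grig: "grig_rigid j \<in> grig"
proof -
  have "(lift_True ^^ i) (lift_True grig_abab) \<in> grig" for i
    using lift_True_abab[of "Suc i"] by (simp only: funpow_Suc_right comp_apply)
  then have "(lift_True ^^ j) (grig_a \<circ> lift_True grig_abab \<circ> grig_a) \<in> grig"
    using grig_gens grig_involutions by (intro lift_True_conj) auto
  then show ?thesis by (simp add: grig_rigid_def grig_a_conj_pair_map)
qed

lemma lift_True_funpow_apply: "(lift_True ^^ j) x (replicate j True @ w) = replicate j True @ x w"
  by (induction j) auto

text \<open>Two letters follow \<open>1^j 0\<close> because \<open>(ab)^2\<close> fixes the first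
  level but sends \<open>00\<close> to \<open>01\<close>. The length \<open>j + 3\<close> is the
  bound in \<open>level_stabilizer\<close>.\<close>

definition grig_vertex :: "nat \<Rightarrow> bool list" where
  "grig_vertex j = replicate j True @ [False, False, False]"

lemma grig_rigid_moves: "grig_rigid j (grig_vertex j) \<noteq> grig_vertex j"
  by (simp add: grig_rigid_def grig_vertex_def lift_True_funpow_apply)

text \<open>For \<open>j < k\<close> the vertex lies below \<open>1^(j+1)\<close>, outside the
  support of \<open>grig_rigid j\<close>.\<close>

lemma grig_rigid_fixes:
  assumes "j < k" shows "grig_rigid j (grig_vertex k) = grig_vertex k"
proof -
  have "grig_vertex k = replicate j True @ True # replicate (k - Suc j) True @ [False, False, False]"
    using assms unfolding grig_vertex_def
    by (metis Suc_leI add_diff_inverse_nat append.assoc append_Cons not_less replicate_Suc replicate_add replicate_app_Cons_same)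
  then show ?thesis by (simp add: grig_rigid_def lift_True_funpow_apply)
qed

section \<open>Level and vertex stabilizers\<close>

definition level_stabilizer :: "nat \<Rightarrow> (bool list \<Rightarrow> bool list) set" where
  "level_stabilizer j = {x \<in> grig. \<forall>w. length w \<le> j + 3 \<longrightarrow> x w = w}"

definition vertex_stabilizer :: "nat \<Rightarrow> (bool list \<Rightarrow> bool list) set" where
  "vertex_stabilizer j = {x \<in> grig. x (grig_vertex j) = grig_vertex j}"

lemma grig_inv_apply:
  assumes "x \<in> grig" shows "x ((inv\<^bsub>grigorchuk_group\<^esub> x) w) = w" "(inv\<^bsub>grigorchuk_group\<^esub> x) (x w) = w"
  using grig_inv[OF assms] by (metis comp_apply id_apply)+

lemma vertex_stabilizer_subgroup: "subgroup (vertex_stabilizer j) grigorchuk_group"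
proof (rule grig.subgroupI)
  show "vertex_stabilizer j \<noteq> {}" using grig_id by (auto simp: vertex_stabilizer_def)
  fix x assume x: "x \<in> vertex_stabilizer j"
  then show "inv\<^bsub>grigorchuk_group\<^esub> x \<in> vertex_stabilizer j"
    using grig_inv_apply(2)[of x "grig_vertex j"] by (auto simp: vertex_stabilizer_def)
qed (auto simp: vertex_stabilizer_def grig_comp)

lemma level_stabilizer_subgroup: "subgroup (level_stabilizer j) grigorchuk_group"
proof (rule grig.subgroupI)
  show "level_stabilizer j \<noteq> {}" using grig_id by (auto simp: level_stabilizer_def)
  fix x assume x: "x \<in> level_stabilizer j"
  then have xc: "x \<in> grig" by (simp add: level_stabilizer_def)
  have "(inv\<^bsub>grigorchuk_group\<^esub> x) w = w" if "length w \<le> j + 3" for w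
    using x that grig_inv_apply(2)[OF xc, of w] by (simp add: level_stabilizer_def)
  then show "inv\<^bsub>grigorchuk_group\<^esub> x \<in> level_stabilizer j"
    using xc by (simp add: level_stabilizer_def)
qed (auto simp: level_stabilizer_def grig_comp)

lemma level_stabilizer_normal: "level_stabilizer j \<lhd> grigorchuk_group"
  unfolding grig.normal_inv_iff
proof (intro conjI ballI level_stabilizer_subgroup)
  fix g x assume gx: "g \<in> grig" "x \<in> level_stabilizer j"
  then have x: "x \<in> grig" by (simp add: level_stabilizer_def)
  have ig: "inv\<^bsub>grigorchuk_group\<^esub> g \<in> grig" using gx by simp
  have "g (x ((inv\<^bsub>grigorchuk_group\<^esub> g) w)) = w" if "length w \<le> j + 3" for w
  proof -
    have "length ((inv\<^bsub>grigorchuk_group\<^esub> g) w) \<le> j + 3" using that grig_length[OF ig] by simp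
    then show ?thesis using gx grig_inv_apply(1)[OF gx(1)] by (simp add: level_stabilizer_def)
  qed
  then show "g \<otimes>\<^bsub>grigorchuk_group\<^esub> x \<otimes>\<^bsub>grigorchuk_group\<^esub> inv\<^bsub>grigorchuk_group\<^esub> g \<in> level_stabilizer j"
    using gx x ig by (simp add: level_stabilizer_def grig_comp)
qed

lemma level_stabilizer_finite_index: "finite (rcosets\<^bsub>grigorchuk_group\<^esub> (level_stabilizer j))"
proof -
  define W where "W = {w :: bool list. length w \<le> j + 3}"
  have finW: "finite W" using finite_lists_length_le[of "UNIV :: bool set" "j + 3"] by (simp add: W_def)
  have "finite_index grigorchuk_group (level_stabilizer j)"
  proof (rule grig.subgroup_index_le(1)[OF level_stabilizer_subgroup, of "W \<rightarrow>\<^sub>E W" "\<lambda>x. restrict x W" j])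
    show "finite (W \<rightarrow>\<^sub>E W)" using finW by (intro finite_PiE)
    show "restrict x W \<in> W \<rightarrow>\<^sub>E W" if "x \<in> grig" for x
      using grig_length[OF that] by (auto simp: W_def)
    fix x y assume xy: "x \<in> grig" "y \<in> grig" "restrict x W = restrict y W"
    have iy: "inv\<^bsub>grigorchuk_group\<^esub> y \<in> grig" using xy by simp
    have "x ((inv\<^bsub>grigorchuk_group\<^esub> y) w) = w" if "w \<in> W" for w
    proof -
      have v: "(inv\<^bsub>grigorchuk_group\<^esub> y) w \<in> W" using that grig_length[OF iy] by (simp add: W_def)
      then have "x ((inv\<^bsub>grigorchuk_group\<^esub> y) w) = y ((inv\<^bsub>grigorchuk_group\<^esub> y) w)"
        using xy(3) by (metis restrict_apply')
      then show ?thesis using grig_inv_apply(1)[OF xy(2)] by simp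
    qed
    then show "x \<otimes>\<^bsub>grigorchuk_group\<^esub> inv\<^bsub>grigorchuk_group\<^esub> y \<in> level_stabilizer j"
      using xy iy by (simp add: level_stabilizer_def W_def grig_comp)
  qed
  then show ?thesis by (simp add: finite_index_def)
qed

lemma coset_tower_grigorchuk:
  assumes "\<And>i. q i > 0"
  shows "coset_tower grigorchuk_group level_stabilizer vertex_stabilizer q"
proof (intro coset_tower.intro coset_tower_axioms.intro)
  show "(\<Inter>i. level_stabilizer i) = {\<one>\<^bsub>grigorchuk_group\<^esub>}"
  proof
    show "(\<Inter>i. level_stabilizer i) \<subseteq> {\<one>\<^bsub>grigorchuk_group\<^esub>}"
    proof
      fix x assume "x \<in> (\<Inter>i. level_stabilizer i)"
      then have "x w = w" for w by (auto simp: level_stabilizer_def dest: spec[of _ "length w"])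
      then show "x \<in> {\<one>\<^bsub>grigorchuk_group\<^esub>}" by auto
    qed
  qed (auto simp: level_stabilizer_def grig_id)
  show "level_stabilizer (Suc i) \<subseteq> level_stabilizer i" "level_stabilizer i \<subseteq> vertex_stabilizer i" for i
    by (auto simp: level_stabilizer_def vertex_stabilizer_def grig_vertex_def)
qed (rule group_grigorchuk level_stabilizer_normal level_stabilizer_finite_index vertex_stabilizer_subgroup assms)+

lemma grigorchuk_torsion_growth:
  "\<exists>(G :: nat monoid) M. group G \<and> finitely_generated G \<and> residually_finite G \<and>
     torsion_growth_chain f G M \<and>
     (\<exists>A. A \<lhd> G \<and> comm_group (G\<lparr>carrier := A\<rparr>) \<and> G Mod A \<cong> grigorchuk_group)"
proof -
  define q where "q = (\<lambda>i. torsion_modulus f (\<lambda>i. card (rcosets\<^bsub>grigorchuk_group\<^esub> (level_stabilizer i))) (Suc i))"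
  have "q i > 0" for i unfolding q_def by (rule torsion_modulus_pos)
  then interpret T: coset_tower grigorchuk_group level_stabilizer vertex_stabilizer q
    by (rule coset_tower_grigorchuk)
  obtain G :: "nat monoid" and e where G: "embedded_group grigorchuk_group level_stabilizer vertex_stabilizer q G e" "finitely_generated G"
    using T.embedded_group_exists[OF finitely_generated_grigorchuk] .
  interpret G: embedded_group grigorchuk_group level_stabilizer vertex_stabilizer q G e by (rule G(1))
  have chain: "torsion_growth_chain f G (\<lambda>i. G.M (Suc i))"
    using grig_rigid_in_grig grig_rigid_moves grig_rigid_fixes
    by (intro G.torsion_growth_chain_M[OF G(2), where g = grig_rigid]) (auto simp: q_def vertex_stabilizer_def)
  show ?thesis
    using chain G(2) G.H.residually_finite_if_chain[OF chain] G.H.is_group G.A_normal G.A_comm_group G.quotient_iso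
    by blast
qed

theorem theorem3:
  fixes f :: "nat \<Rightarrow> nat"
  shows "(\<exists>(G :: nat monoid) M. group G \<and> finitely_generated G \<and> residually_finite G \<and>
            torsion_growth_chain f G M) \<and>
         (\<exists>(G :: nat monoid) M. group G \<and> finitely_generated G \<and> residually_finite G \<and>
            torsion_growth_chain f G M \<and>
            solvable G \<and> derived_length G = 3) \<and>
         (\<exists>(G :: nat monoid) M. group G \<and> finitely_generated G \<and> residually_finite G \<and>
            torsion_growth_chain f G M \<and>
            (\<exists>A. A \<lhd> G \<and> comm_group (G\<lparr>carrier := A\<rparr>) \<and> G Mod A \<cong> grigorchuk_group))"
  using solvable_torsion_growth[of f] grigorchuk_torsion_growth[of f] by blast

end
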